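(* There exist a Banach space $X$ with a normalized unconditional (Schauder) basis $(b_n)_{n\in\mathbb N}$, with coordinate functionals $b_n^*\in X^*$, and a bounded linear operator $T\colon X\to X$ such that $T$ has large diagonal, that is, $\inf_{n\in\mathbb N}|\langle Tb_n,b_n^*\rangle|>0$, but the identity operator $I_X$ does not factor through $T$, that is, there are no bounded linear operators $R,S\colon X\to X$ with $I_X=STR$.
   Context: A basis always means a Schauder basis, indexed by $\mathbb N$ (so $X$ is infinite-dimensional). An operator on $X$ is a bounded linear map from $X$ into itself. $\langle\cdot,\cdot\rangle$ denotes the bilinear duality pairing between $X$ and its dual space $X^*$, and $b_n^*\in X^*$ is the $n$-th coordinate functional of the basis. *)

theory Defs
  imports "HOL-Analysis.Analysis" "HOL-Library.Function_Algebras"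
begin

text \<open>
  HOL cannot quantify existentially over types, so a Banach space is given by a linear subspace
  \<open>X\<close> (the set of its vectors) of an ambient vector space, together with a norm \<open>N\<close>, which is
  only meaningful on \<open>X\<close> and need not come from any norm or topology on the ambient type.
  The scalar field is a type \<open>'k\<close> of class \<^class>\<open>real_normed_field\<close>, which up to isomorphism
  means the real or the complex numbers. Operators on the space are functions on the ambient type whose
  values outside \<open>X\<close> are irrelevant.

  As ambient type one may take \<open>nat \<Rightarrow> 'k\<close>, with the pointwise addition of
  \<^theory>\<open>HOL-Library.Function_Algebras\<close>: the coordinates with respect to a Schauder basis
  embed any space with such a basis linearly into it.
\<close>

locale banach_space = vector_space scale
  for scale :: "'k::real_normed_field \<Rightarrow> 'v::ab_group_add \<Rightarrow> 'v" (infixr "*s" 75) +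
  fixes X :: "'v set" and N :: "'v \<Rightarrow> real"
  assumes subspace_X: "subspace X"
    and N_nonneg: "x \<in> X \<Longrightarrow> 0 \<le> N x"
    and N_eq_0_iff: "x \<in> X \<Longrightarrow> N x = 0 \<longleftrightarrow> x = 0"
    and N_triangle: "x \<in> X \<Longrightarrow> y \<in> X \<Longrightarrow> N (x + y) \<le> N x + N y"
    and N_scale: "x \<in> X \<Longrightarrow> N (a *s x) = norm a * N x"
    and N_complete: "(\<And>n. \<sigma> n \<in> X) \<Longrightarrow>
      (\<And>e. e > 0 \<Longrightarrow> \<exists>M. \<forall>m\<ge>M. \<forall>n\<ge>M. N (\<sigma> m - \<sigma> n) < e) \<Longrightarrow>
      \<exists>x\<in>X. (\<lambda>n. N (\<sigma> n - x)) \<longlonglongrightarrow> 0"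
begin

definition series_converges_to :: "(nat \<Rightarrow> 'v) \<Rightarrow> 'v \<Rightarrow> bool" where
  "series_converges_to u x \<longleftrightarrow> (\<lambda>m. N ((\<Sum>k<m. u k) - x)) \<longlonglongrightarrow> 0"

definition schauder_basis :: "(nat \<Rightarrow> 'v) \<Rightarrow> bool" where
  "schauder_basis b \<longleftrightarrow> (\<forall>n. b n \<in> X) \<and>
     (\<forall>x\<in>X. \<exists>!a. series_converges_to (\<lambda>k. a k *s b k) x)"

text \<open>\<open>coordinate b n x\<close> is the pairing of \<open>x\<close> with the \<open>n\<close>-th coordinate functional of the
  Schauder basis \<open>b\<close>.\<close>

definition coordinate :: "(nat \<Rightarrow> 'v) \<Rightarrow> nat \<Rightarrow> 'v \<Rightarrow> 'k" where
  "coordinate b n x = (THE a. series_converges_to (\<lambda>k. a k *s b k) x) n"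

text \<open>A basis is unconditional if the basis expansion of every vector converges, in any order of
  its terms, to that vector.\<close>

definition unconditional_basis :: "(nat \<Rightarrow> 'v) \<Rightarrow> bool" where
  "unconditional_basis b \<longleftrightarrow> schauder_basis b \<and>
     (\<forall>x\<in>X. \<forall>\<pi>. bij \<pi> \<longrightarrow>
        series_converges_to (\<lambda>k. coordinate b (\<pi> k) x *s b (\<pi> k)) x)"

definition normalized :: "(nat \<Rightarrow> 'v) \<Rightarrow> bool" where
  "normalized b \<longleftrightarrow> (\<forall>n. N (b n) = 1)"

definition bounded_operator :: "('v \<Rightarrow> 'v) \<Rightarrow> bool" where
  "bounded_operator T \<longleftrightarrow> (\<forall>x\<in>X. T x \<in> X) \<and>
     (\<forall>x\<in>X. \<forall>y\<in>X. T (x + y) = T x + T y) \<and>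
     (\<forall>a. \<forall>x\<in>X. T (a *s x) = a *s T x) \<and>
     (\<exists>C. \<forall>x\<in>X. N (T x) \<le> C * N x)"

definition large_diagonal :: "(nat \<Rightarrow> 'v) \<Rightarrow> ('v \<Rightarrow> 'v) \<Rightarrow> bool" where
  "large_diagonal b T \<longleftrightarrow> (INF n. norm (coordinate b n (T (b n)))) > 0"

definition identity_factors_through :: "('v \<Rightarrow> 'v) \<Rightarrow> bool" where
  "identity_factors_through T \<longleftrightarrow>
     (\<exists>R S. bounded_operator R \<and> bounded_operator S \<and> (\<forall>x\<in>X. x = S (T (R x))))"

end

end

theory Submission
  imports Defs
begin

text \<open>
  The space is a variant of Figiel's space that is not isomorphic to its square: the Luxemburg norm
  of the modular \<open>\<Sum>j. |x j| powr p j\<close>, where the exponents \<open>p j\<close> decrease to \<open>2\<close> and are constant on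
  blocks of rapidly growing length. The operator \<open>T\<close> adds up the two entries in each pair of
  coordinates \<open>2i\<close>, \<open>2i+1\<close> and writes the sum into both of them. Its diagonal is \<open>1\<close>, but \<open>T\<close> factors
  through half of the space.

  Suppose \<open>S T R = I\<close>, and consider a block of length \<open>n\<close> and exponent \<open>P\<close>. As \<open>T\<close> only retains half of the
  coordinates, \<open>T R\<close> maps a subspace \<open>W\<close> of the block of dimension proportional to \<open>n\<close> into
  the later blocks, whose exponents are at most \<open>q < P\<close>. Let \<open>w t\<close> be the orthogonal projections of the unit
  vectors to \<open>W\<close>. The sum of \<open>|w t|\<^sup>2\<close> over \<open>t\<close> is bounded in each coordinate, so random signed sums of the \<open>w t\<close>
  have norm of order at most \<open>n powr (1/P)\<close>. On the other hand a proportion of the \<open>w t\<close>, hence of the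
  \<open>T R (w t)\<close>, has norm bounded below, and since \<open>q \<ge> 2\<close>, signed sums of the latter have norm of order at
  least \<open>n powr (1/q)\<close>. This is a contradiction for large \<open>n\<close>.
\<close>

section \<open>Nakano sequence spaces\<close>

lemma powr_convex_nonneg:
  fixes a b p u v :: real
  assumes "1 \<le> p" "0 \<le> a" "0 \<le> b" "0 \<le> u" "0 \<le> v" "u + v = 1"
  shows "(u * a + v * b) powr p \<le> u * a powr p + v * b powr p"
proof -
  have *: "(u * a) powr p \<le> u * a powr p" if "0 \<le> u" "u \<le> 1" for u a :: real
  proof -
    have "u powr p \<le> u powr 1" if "u \<noteq> 0"
      using powr_mono'[of 1 p u] \<open>1 \<le> p\<close> \<open>0 \<le> u\<close> \<open>u \<le> 1\<close> by simp
    then have "u powr p \<le> u" using \<open>0 \<le> u\<close> by (cases "u = 0") auto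
    then show ?thesis by (simp add: powr_mult mult_right_mono)
  qed
  \<comment> \<open>If one argument vanishes, the claim reduces to \<open>*\<close> for the other
    one; for two positive arguments it is convexity of the power.\<close>
  consider "a = 0" | "b = 0" | "a > 0" "b > 0" using assms by linarith
  then show ?thesis
  proof cases
    case 1
    then show ?thesis using *[of v b] assms by simp
  next
    case 2
    then show ?thesis using *[of u a] assms by simp
  next
    case 3
    then show ?thesis
      using convex_onD[OF powr_convex[OF assms(1)], of v a b] assms
      by (simp add: eq_diff_eq[symmetric])
  qed
qed

text \<open>Split off one factor of each power and enlarge the remaining factor
  \<open>x powr (s - 1)\<close> to \<open>(a + b) powr (s - 1)\<close>.\<close>

lemma powr_superadditive:
  fixes a b s :: real
  assumes "1 \<le> s" "0 \<le> a" "0 \<le> b"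
  shows "a powr s + b powr s \<le> (a + b) powr s"
proof -
  have *: "x * x powr (s - 1) = x powr s" if "0 \<le> x" for x :: real
    using powr_mult_base[of x "s - 1"] that by simp
  have "a * a powr (s - 1) + b * b powr (s - 1)
      \<le> a * (a + b) powr (s - 1) + b * (a + b) powr (s - 1)"
    using assms by (intro add_mono mult_left_mono powr_mono2) auto
  also have "\<dots> = (a + b) * (a + b) powr (s - 1)" by (simp add: algebra_simps)
  finally show ?thesis using assms by (simp add: *)
qed

text \<open>The parallelogram law for squared norms, combined with superadditivity and convexity of
  the power \<open>q / 2\<close>, which is at least 1. Iterating it gives the lower bound for random
  signed sums.\<close>

lemma powr_two_point:
  fixes v x :: "'a::real_inner" and q :: real
  assumes "2 \<le> q"
  shows "norm v powr q + norm x powr q \<le> (norm (v + x) powr q + norm (v - x) powr q) / 2"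
proof -
  have sq: "(norm y)\<^sup>2 powr (q / 2) = norm y powr q" for y :: 'a
    using assms by (cases "norm y = 0") (simp_all add: powr_powr flip: powr_numeral)
  have "norm v powr q + norm x powr q \<le> ((norm v)\<^sup>2 + (norm x)\<^sup>2) powr (q / 2)"
    using powr_superadditive[of "q / 2" "(norm v)\<^sup>2" "(norm x)\<^sup>2"] assms by (simp add: sq)
  also have "(norm v)\<^sup>2 + (norm x)\<^sup>2 = (1/2) * (norm (v + x))\<^sup>2 + (1/2) * (norm (v - x))\<^sup>2"
    by (simp add: power2_norm_eq_inner inner_simps inner_commute add_divide_distrib diff_divide_distrib)
  also have "\<dots> powr (q / 2)
      \<le> (1/2) * (norm (v + x))\<^sup>2 powr (q / 2) + (1/2) * (norm (v - x))\<^sup>2 powr (q / 2)"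
    using assms by (intro powr_convex_nonneg) auto
  finally show ?thesis by (simp add: sq)
qed

section \<open>The modular, its sequence space and its Luxemburg norm\<close>

definition modular :: "(nat \<Rightarrow> real) \<Rightarrow> nat set \<Rightarrow> (nat \<Rightarrow> 'a::real_normed_vector) \<Rightarrow> real" where
  "modular p F x = (\<Sum>j\<in>F. norm (x j) powr p j)"

text \<open>A uniform bound over finite sets of coordinates expresses convergence of the full
  nonnegative series.\<close>

definition nakano_space :: "(nat \<Rightarrow> real) \<Rightarrow> (nat \<Rightarrow> 'a::real_normed_vector) set" where
  "nakano_space p = {x. \<exists>B. \<forall>F. finite F \<longrightarrow> modular p F x \<le> B}"

definition nakano_norm :: "(nat \<Rightarrow> real) \<Rightarrow> (nat \<Rightarrow> 'a::real_normed_vector) \<Rightarrow> real" where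
  "nakano_norm p x = Inf {t. 0 < t \<and> (\<forall>F. finite F \<longrightarrow> modular p F (\<lambda>j. x j /\<^sub>R t) \<le> 1)}"

lemma modular_nonneg: "0 \<le> modular p F x"
  by (simp add: modular_def sum_nonneg)

lemma modular_mono_set: "finite G \<Longrightarrow> F \<subseteq> G \<Longrightarrow> modular p F x \<le> modular p G x"
  unfolding modular_def by (rule sum_mono2) auto

text \<open>The lower bound 2 is what \<open>powr_two_point\<close> asks for. The upper bound 4
  allows comparison with fourth powers, both when dilating vectors and when estimating moments of
  random sums.\<close>

locale nakano =
  fixes p :: "nat \<Rightarrow> real"
  assumes p_ge2: "2 \<le> p j" and p_le4: "p j \<le> 4"
begin

lemma modular_mono:
  assumes "\<And>j. j \<in> F \<Longrightarrow> norm (x j) \<le> norm (y j)"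
  shows "modular p F x \<le> modular p F y"
  unfolding modular_def
proof (rule sum_mono)
  show "norm (x j) powr p j \<le> norm (y j) powr p j" if "j \<in> F" for j
    using assms[OF that] p_ge2[of j] by (intro powr_mono2) auto
qed

lemma modular_scale: "modular p F (\<lambda>j. c *\<^sub>R x j) = (\<Sum>j\<in>F. \<bar>c\<bar> powr p j * norm (x j) powr p j)"
  by (simp add: modular_def powr_mult)

lemma modular_scale_le:
  assumes "\<And>j. j \<in> F \<Longrightarrow> \<bar>c\<bar> powr p j \<le> K"
  shows "modular p F (\<lambda>j. c *\<^sub>R x j) \<le> K * modular p F x"
  unfolding modular_scale unfolding modular_def sum_distrib_left
  using assms by (intro sum_mono mult_right_mono) auto

lemma modular_scale_le_power4:
  assumes "1 \<le> c"
  shows "modular p F (\<lambda>j. c *\<^sub>R x j) \<le> c ^ 4 * modular p F x"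
proof (rule modular_scale_le)
  show "\<bar>c\<bar> powr p j \<le> c ^ 4" for j
    using powr_mono[of "p j" 4 c] p_le4 assms by simp
qed

lemma modular_scale_le_self:
  assumes "0 \<le> c" "c \<le> 1"
  shows "modular p F (\<lambda>j. c *\<^sub>R x j) \<le> c * modular p F x"
proof (rule modular_scale_le)
  show "\<bar>c\<bar> powr p j \<le> c" for j
    using powr_mono'[of 1 "p j" c] p_ge2[of j] assms by (cases "c = 0") auto
qed

lemma modular_convex:
  assumes "0 \<le> u" "0 \<le> v" "u + v = 1"
  shows "modular p F (\<lambda>j. u *\<^sub>R x j + v *\<^sub>R y j) \<le> u * modular p F x + v * modular p F y"
proof -
  have "modular p F (\<lambda>j. u *\<^sub>R x j + v *\<^sub>R y j)
      \<le> (\<Sum>j\<in>F. u * norm (x j) powr p j + v * norm (y j) powr p j)"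
    unfolding modular_def
  proof (rule sum_mono)
    fix j
    have "norm (u *\<^sub>R x j + v *\<^sub>R y j) \<le> u * norm (x j) + v * norm (y j)"
      using assms by (metis norm_triangle_mono norm_scaleR abs_of_nonneg order_refl)
    then have "norm (u *\<^sub>R x j + v *\<^sub>R y j) powr p j \<le> (u * norm (x j) + v * norm (y j)) powr p j"
      using p_ge2[of j] by (intro powr_mono2) auto
    also have "\<dots> \<le> u * norm (x j) powr p j + v * norm (y j) powr p j"
      using p_ge2[of j] assms by (intro powr_convex_nonneg) auto
    finally show "norm (u *\<^sub>R x j + v *\<^sub>R y j) powr p j
      \<le> u * norm (x j) powr p j + v * norm (y j) powr p j" .
  qed
  then show ?thesis by (simp add: modular_def sum.distrib sum_distrib_left)
qed

lemma nakano_spaceI: "(\<And>F. finite F \<Longrightarrow> modular p F x \<le> B) \<Longrightarrow> x \<in> nakano_space p"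
  unfolding nakano_space_def by blast

lemma nakano_spaceE:
  assumes "x \<in> nakano_space p"
  obtains B where "1 \<le> B" "\<And>F. finite F \<Longrightarrow> modular p F x \<le> B"
proof -
  obtain B where "\<And>F. finite F \<Longrightarrow> modular p F x \<le> B"
    using assms unfolding nakano_space_def by blast
  then show ?thesis by (intro that[of "max 1 B"]) (auto simp: le_max_iff_disj)
qed

lemma scaleR_nakano_space:
  assumes "x \<in> nakano_space p"
  shows "(\<lambda>j. c *\<^sub>R x j) \<in> nakano_space p"
proof -
  obtain B where B: "1 \<le> B" "\<And>F. finite F \<Longrightarrow> modular p F x \<le> B"
    using nakano_spaceE[OF assms] by blast
  show ?thesis
  proof (rule nakano_spaceI)
    fix F :: "nat set" assume F: "finite F"
    \<comment> \<open>Enlarging the factor to \<open>1 + \<bar>c\<bar>\<close> makes it at least 1,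
      as the fourth-power bound requires.\<close>
    have "modular p F (\<lambda>j. c *\<^sub>R x j) \<le> modular p F (\<lambda>j. (1 + \<bar>c\<bar>) *\<^sub>R x j)"
      by (rule modular_mono) (auto intro!: mult_right_mono)
    also have "\<dots> \<le> (1 + \<bar>c\<bar>) ^ 4 * modular p F x"
      by (rule modular_scale_le_power4) simp
    also have "\<dots> \<le> (1 + \<bar>c\<bar>) ^ 4 * B"
      using B(2)[OF F] by (intro mult_left_mono) auto
    finally show "modular p F (\<lambda>j. c *\<^sub>R x j) \<le> (1 + \<bar>c\<bar>) ^ 4 * B" .
  qed
qed

lemma nakano_space_mono:
  assumes "y \<in> nakano_space p" "\<And>j. norm (x j) \<le> norm (y j)"
  shows "x \<in> nakano_space p"
proof -
  obtain B where B: "1 \<le> B" "\<And>F. finite F \<Longrightarrow> modular p F y \<le> B"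
    using nakano_spaceE[OF assms(1)] by blast
  then show ?thesis
    by (intro nakano_spaceI[of _ B]) (meson assms(2) modular_mono order_trans)
qed

lemma add_nakano_space:
  assumes "x \<in> nakano_space p" "y \<in> nakano_space p"
  shows "x + y \<in> nakano_space p"
proof -
  obtain B C where B: "\<And>F. finite F \<Longrightarrow> modular p F (\<lambda>j. 2 *\<^sub>R x j) \<le> B"
    and C: "\<And>F. finite F \<Longrightarrow> modular p F (\<lambda>j. 2 *\<^sub>R y j) \<le> C"
    using assms[THEN scaleR_nakano_space] by (metis nakano_spaceE)
  show ?thesis
  proof (rule nakano_spaceI)
    fix F :: "nat set" assume F: "finite F"
    \<comment> \<open>The sum is the midpoint of the doubled vectors, so convexity applies.\<close>
    have "modular p F (x + y)
        = modular p F (\<lambda>j. (1/2::real) *\<^sub>R (2 *\<^sub>R x j) + (1/2::real) *\<^sub>R (2 *\<^sub>R y j))"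
      by (simp add: plus_fun_def)
    also have "\<dots> \<le> (1/2) * modular p F (\<lambda>j. 2 *\<^sub>R x j) + (1/2) * modular p F (\<lambda>j. 2 *\<^sub>R y j)"
      by (rule modular_convex) auto
    also have "\<dots> \<le> (1/2) * B + (1/2) * C" using B[OF F] C[OF F] by simp
    finally show "modular p F (x + y) \<le> (1/2) * B + (1/2) * C" .
  qed
qed

lemma modular_unit_scale_mono:
  assumes "0 < s" "s \<le> t" "modular p F (\<lambda>j. x j /\<^sub>R s) \<le> 1"
  shows "modular p F (\<lambda>j. x j /\<^sub>R t) \<le> 1"
proof -
  have "modular p F (\<lambda>j. x j /\<^sub>R t) \<le> modular p F (\<lambda>j. x j /\<^sub>R s)"
    using assms by (intro modular_mono) (auto intro!: mult_right_mono simp: field_simps)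
  then show ?thesis using assms by linarith
qed

text \<open>The infimum defining the norm is attained: the modular of \<open>x / t\<close> depends
  continuously on \<open>t\<close>, so the bound 1 survives the passage to the limit from above. All
  later norm estimates go through this criterion.\<close>

lemma nakano_norm_le_iff:
  assumes "x \<in> nakano_space p" "0 < t"
  shows "nakano_norm p x \<le> t \<longleftrightarrow> (\<forall>F. finite F \<longrightarrow> modular p F (\<lambda>j. x j /\<^sub>R t) \<le> 1)"
    (is "_ \<longleftrightarrow> ?P t")
proof
  let ?S = "{t. 0 < t \<and> ?P t}"
  have bdd: "bdd_below ?S" by (auto intro!: bdd_belowI[of _ 0])
  obtain B where B: "1 \<le> B" "\<And>F. finite F \<Longrightarrow> modular p F x \<le> B"
    using nakano_spaceE[OF assms(1)] by blast
  \<comment> \<open>Dividing by \<open>B\<close>, which is at least 1, shrinks the modular by at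
    least the factor \<open>1 / B\<close>; hence the infimum is over a nonempty set.\<close>
  have "?P B"
  proof (intro allI impI)
    fix F :: "nat set" assume F: "finite F"
    have "modular p F (\<lambda>j. x j /\<^sub>R B) \<le> inverse B * modular p F x"
      using B by (intro modular_scale_le_self) (auto simp: field_simps)
    also have "\<dots> \<le> inverse B * B" using B F by (intro mult_left_mono) auto
    finally show "modular p F (\<lambda>j. x j /\<^sub>R B) \<le> 1" using B by simp
  qed
  then have "B \<in> ?S" using B(1) by simp
  then have ne: "?S \<noteq> {}" by blast
  show "?P t \<Longrightarrow> nakano_norm p x \<le> t"
    unfolding nakano_norm_def using assms(2) by (intro cInf_lower bdd) auto
  assume le: "nakano_norm p x \<le> t"
  show "?P t"
  proof (intro allI impI)
    fix F :: "nat set" assume F: "finite F"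
    \<comment> \<open>Every \<open>s > t\<close> is admissible, and passing from
      \<open>x / s\<close> to \<open>x / t\<close> costs at most \<open>(s / t) ^ 4\<close>, which
      tends to 1.\<close>
    have above: "modular p F (\<lambda>j. x j /\<^sub>R t) \<le> (s / t) ^ 4" if "t < s" for s
    proof -
      have "Inf ?S < s" using le that unfolding nakano_norm_def by linarith
      then obtain r where r: "r < s" "0 < r" "?P r"
        using cInf_less_iff[OF ne bdd, of s] by blast
      then have "modular p F (\<lambda>j. x j /\<^sub>R s) \<le> 1"
        using F by (intro modular_unit_scale_mono[of r s]) auto
      moreover have "modular p F (\<lambda>j. (s / t) *\<^sub>R (x j /\<^sub>R s)) \<le> (s / t) ^ 4 * modular p F (\<lambda>j. x j /\<^sub>R s)"
        using that assms by (intro modular_scale_le_power4) (auto simp: field_simps)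
      moreover have "(\<lambda>j. (s / t) *\<^sub>R (x j /\<^sub>R s)) = (\<lambda>j. x j /\<^sub>R t)"
        using that assms by (simp add: fun_eq_iff divide_inverse)
      moreover have "(s / t) ^ 4 * modular p F (\<lambda>j. x j /\<^sub>R s) \<le> (s / t) ^ 4"
        using calculation(1) by (intro mult_left_le) auto
      ultimately show ?thesis by (metis order_trans)
    qed
    have "((\<lambda>s. (s / t) ^ 4) \<longlongrightarrow> (t / t) ^ 4) (at_right t)"
      by (intro tendsto_intros) (use assms in auto)
    then have "((\<lambda>s. (s / t) ^ 4) \<longlongrightarrow> 1) (at_right t)" using assms by simp
    moreover have "\<forall>\<^sub>F s in at_right t. modular p F (\<lambda>j. x j /\<^sub>R t) \<le> (s / t) ^ 4"
      using above by (auto simp: eventually_at_filter)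
    ultimately show "modular p F (\<lambda>j. x j /\<^sub>R t) \<le> 1"
      by (intro tendsto_lowerbound[where F = "at_right t"]) auto
  qed
qed

text \<open>The infimum is only informative over a nonempty set. A negative norm would be at most 1,
  so the criterion would put 1 into that set, whose elements are all positive.\<close>

lemma nakano_norm_nonneg:
  assumes "x \<in> nakano_space p"
  shows "0 \<le> nakano_norm p x"
proof (rule ccontr)
  assume neg: "\<not> 0 \<le> nakano_norm p x"
  let ?S = "{t. 0 < t \<and> (\<forall>F. finite F \<longrightarrow> modular p F (\<lambda>j. x j /\<^sub>R t) \<le> 1)}"
  have "1 \<in> ?S"
    using nakano_norm_le_iff[OF assms, of 1] neg by simp
  then have "?S \<noteq> {}" by blast
  then have "0 \<le> Inf ?S" by (intro cInf_greatest) auto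
  then show False using neg by (simp add: nakano_norm_def)
qed

lemma norm_le_nakano_norm:
  assumes "x \<in> nakano_space p"
  shows "norm (x j) \<le> nakano_norm p x"
proof (rule dense_ge)
  fix t assume "nakano_norm p x < t"
  moreover from this have "0 < t" using nakano_norm_nonneg[OF assms] by linarith
  ultimately have "modular p {j} (\<lambda>j. x j /\<^sub>R t) \<le> 1"
    using nakano_norm_le_iff[OF assms, of t] by auto
  then have le1: "(norm (x j) / t) powr p j \<le> 1"
    using \<open>0 < t\<close> by (simp add: modular_def divide_inverse mult.commute)
  show "norm (x j) \<le> t"
  proof (rule ccontr)
    assume "\<not> norm (x j) \<le> t"
    then have "1 < norm (x j) / t" using \<open>0 < t\<close> by simp
    then have "1 powr p j < (norm (x j) / t) powr p j"
      using p_ge2[of j] by (intro powr_less_mono2) auto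
    then show False using le1 by simp
  qed
qed

lemma nakano_norm_le:
  assumes "\<And>F. finite F \<Longrightarrow> modular p F (\<lambda>j. x j /\<^sub>R t) \<le> 1" "0 < t"
  shows "x \<in> nakano_space p" "nakano_norm p x \<le> t"
proof -
  have "(\<lambda>j. x j /\<^sub>R t) \<in> nakano_space p" using assms by (intro nakano_spaceI)
  then have "(\<lambda>j. t *\<^sub>R (x j /\<^sub>R t)) \<in> nakano_space p" by (rule scaleR_nakano_space)
  then show "x \<in> nakano_space p" using \<open>0 < t\<close> by simp
  then show "nakano_norm p x \<le> t" using nakano_norm_le_iff assms by blast
qed

lemma zero_nakano_space: "0 \<in> nakano_space p"
  by (rule nakano_spaceI[of _ 0]) (simp add: modular_def)

lemma nakano_norm_zero: "nakano_norm p 0 = 0"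
proof (rule antisym)
  show "nakano_norm p (0::nat \<Rightarrow> 'a) \<le> 0"
    by (rule dense_ge) (auto simp: nakano_norm_le_iff[OF zero_nakano_space] modular_def)
qed (rule nakano_norm_nonneg[OF zero_nakano_space])

lemma nakano_norm_eq_0_iff:
  assumes "x \<in> nakano_space p"
  shows "nakano_norm p x = 0 \<longleftrightarrow> x = 0"
proof
  assume "nakano_norm p x = 0"
  then have "norm (x j) \<le> 0" for j using norm_le_nakano_norm[OF assms, of j] by simp
  then show "x = 0" by (simp add: fun_eq_iff)
qed (simp add: nakano_norm_zero)

lemma nakano_norm_triangle:
  assumes "x \<in> nakano_space p" "y \<in> nakano_space p"
  shows "nakano_norm p (x + y) \<le> nakano_norm p x + nakano_norm p y"
proof (rule field_le_epsilon)
  fix e :: real assume "0 < e"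
  \<comment> \<open>The slack \<open>e / 2\<close> keeps both numbers positive even for zero
    vectors, so they can serve as weights of a convex combination.\<close>
  define s t where "s = nakano_norm p x + e / 2" and "t = nakano_norm p y + e / 2"
  have pos: "0 < s" "0 < t"
    using \<open>0 < e\<close> assms[THEN nakano_norm_nonneg] by (auto simp: s_def t_def)
  have "modular p F (\<lambda>j. (x + y) j /\<^sub>R (s + t)) \<le> 1" if F: "finite F" for F
  proof -
    have st: "modular p F (\<lambda>j. x j /\<^sub>R s) \<le> 1" "modular p F (\<lambda>j. y j /\<^sub>R t) \<le> 1"
      using nakano_norm_le_iff[OF assms(1) pos(1)] nakano_norm_le_iff[OF assms(2) pos(2)] \<open>0 < e\<close> F
      by (auto simp: s_def t_def)
    have unit: "s / (s + t) + t / (s + t) = 1"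
      using pos by (simp add: add_divide_distrib[symmetric])
    have "(\<lambda>j. (x + y) j /\<^sub>R (s + t))
        = (\<lambda>j. (s / (s + t)) *\<^sub>R (x j /\<^sub>R s) + (t / (s + t)) *\<^sub>R (y j /\<^sub>R t))"
      using pos by (simp add: fun_eq_iff scaleR_right_distrib inverse_eq_divide)
    then have "modular p F (\<lambda>j. (x + y) j /\<^sub>R (s + t)) = modular p F
        (\<lambda>j. (s / (s + t)) *\<^sub>R (x j /\<^sub>R s) + (t / (s + t)) *\<^sub>R (y j /\<^sub>R t))"
      by (rule arg_cong)
    also have "\<dots> \<le> s / (s + t) * modular p F (\<lambda>j. x j /\<^sub>R s) + t / (s + t) * modular p F (\<lambda>j. y j /\<^sub>R t)"
      using pos unit by (intro modular_convex) auto
    also have "\<dots> \<le> s / (s + t) * 1 + t / (s + t) * 1"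
      using st pos by (intro add_mono mult_left_mono) auto
    finally show ?thesis using pos by (simp add: add_divide_distrib[symmetric])
  qed
  then have "nakano_norm p (x + y) \<le> s + t" using nakano_norm_le(2) pos by (metis add_pos_pos)
  then show "nakano_norm p (x + y) \<le> nakano_norm p x + nakano_norm p y + e"
    by (simp add: s_def t_def)
qed

lemma nakano_norm_scale:
  fixes x :: "nat \<Rightarrow> 'k::real_normed_field"
  assumes "x \<in> nakano_space p"
  shows "(\<lambda>j. a * x j) \<in> nakano_space p" "nakano_norm p (\<lambda>j. a * x j) = norm a * nakano_norm p x"
proof -
  show ax: "(\<lambda>j. a * x j) \<in> nakano_space p"
    by (rule nakano_space_mono[OF scaleR_nakano_space[OF assms, of "norm a"]]) (simp add: norm_mult)
  have le_iff: "nakano_norm p (\<lambda>j. a * x j) \<le> t \<longleftrightarrow> norm a * nakano_norm p x \<le> t"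
    if "0 < t" "a \<noteq> 0" for t
  proof -
    have "modular p F (\<lambda>j. (a * x j) /\<^sub>R t) = modular p F (\<lambda>j. x j /\<^sub>R (t / norm a))" for F
      using that by (simp add: modular_def norm_mult field_simps)
    then have "nakano_norm p (\<lambda>j. a * x j) \<le> t \<longleftrightarrow> nakano_norm p x \<le> t / norm a"
      using nakano_norm_le_iff[OF ax] nakano_norm_le_iff[OF assms, of "t / norm a"] that by simp
    then show ?thesis using that by (simp add: field_simps)
  qed
  show "nakano_norm p (\<lambda>j. a * x j) = norm a * nakano_norm p x"
  proof (cases "a = 0")
    case True
    then show ?thesis using nakano_norm_zero by (simp add: zero_fun_def)
  next
    case False
    have "0 \<le> norm a * nakano_norm p x" using nakano_norm_nonneg[OF assms] by simp
    show ?thesis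
    proof (rule antisym)
      show "nakano_norm p (\<lambda>j. a * x j) \<le> norm a * nakano_norm p x"
      proof (rule dense_ge)
        show "nakano_norm p (\<lambda>j. a * x j) \<le> t" if "norm a * nakano_norm p x < t" for t
          using le_iff[OF _ False, of t] \<open>0 \<le> norm a * nakano_norm p x\<close> that by linarith
      qed
      show "norm a * nakano_norm p x \<le> nakano_norm p (\<lambda>j. a * x j)"
      proof (rule dense_ge)
        show "norm a * nakano_norm p x \<le> t" if "nakano_norm p (\<lambda>j. a * x j) < t" for t
          using le_iff[OF _ False, of t] nakano_norm_nonneg[OF ax] that by linarith
      qed
    qed
  qed
qed

text \<open>The norm dominates each coordinate, which gives a pointwise limit. On a fixed finite set
  the modular is continuous in the coordinates, so the Cauchy bound passes to the limit.\<close>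

lemma nakano_complete:
  fixes \<sigma> :: "nat \<Rightarrow> nat \<Rightarrow> 'a::banach"
  assumes in_space: "\<And>n. \<sigma> n \<in> nakano_space p"
    and Cauchy: "\<And>e. 0 < e \<Longrightarrow> \<exists>M. \<forall>m\<ge>M. \<forall>n\<ge>M. nakano_norm p (\<sigma> m - \<sigma> n) < e"
  shows "\<exists>x\<in>nakano_space p. (\<lambda>n. nakano_norm p (\<sigma> n - x)) \<longlonglongrightarrow> 0"
proof -
  have neg: "- y \<in> nakano_space p" if "y \<in> nakano_space p" for y :: "nat \<Rightarrow> 'a"
    by (rule nakano_space_mono[OF that]) simp
  have diff: "y - z \<in> nakano_space p" if "y \<in> nakano_space p" "z \<in> nakano_space p"
    for y z :: "nat \<Rightarrow> 'a"
    using add_nakano_space[OF that(1) neg[OF that(2)]] by simp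
  have "convergent (\<lambda>n. \<sigma> n j)" for j
  proof (rule Cauchy_convergent, rule CauchyI)
    fix e :: real assume "0 < e"
    then obtain M where M: "\<forall>m\<ge>M. \<forall>n\<ge>M. nakano_norm p (\<sigma> m - \<sigma> n) < e"
      using Cauchy by blast
    have "norm (\<sigma> m j - \<sigma> n j) \<le> nakano_norm p (\<sigma> m - \<sigma> n)" for m n
      using norm_le_nakano_norm[OF diff[OF in_space in_space], where j=j] by simp
    then show "\<exists>M. \<forall>m\<ge>M. \<forall>n\<ge>M. norm (\<sigma> m j - \<sigma> n j) < e"
      using M by (meson le_less_trans)
  qed
  then obtain x where x: "\<And>j. (\<lambda>n. \<sigma> n j) \<longlonglongrightarrow> x j"
    unfolding convergent_def by metis
  have close: "\<exists>M. \<forall>m\<ge>M. \<sigma> m - x \<in> nakano_space p \<and> nakano_norm p (\<sigma> m - x) \<le> e"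
    if "0 < e" for e
  proof -
    obtain M where M: "\<forall>m\<ge>M. \<forall>n\<ge>M. nakano_norm p (\<sigma> m - \<sigma> n) < e"
      using Cauchy \<open>0 < e\<close> by blast
    have "modular p F (\<lambda>j. (\<sigma> m - x) j /\<^sub>R e) \<le> 1" if "m \<ge> M" "finite F" for m F
    proof (rule tendsto_upperbound[where F = sequentially])
      show "(\<lambda>n. modular p F (\<lambda>j. (\<sigma> m - \<sigma> n) j /\<^sub>R e)) \<longlonglongrightarrow> modular p F (\<lambda>j. (\<sigma> m - x) j /\<^sub>R e)"
        unfolding modular_def minus_apply
        using p_ge2 by (intro tendsto_sum tendsto_powr' tendsto_norm tendsto_scaleR tendsto_diff
          tendsto_const x) (auto simp: less_le_trans[OF zero_less_numeral p_ge2])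
      show "\<forall>\<^sub>F n in sequentially. modular p F (\<lambda>j. (\<sigma> m - \<sigma> n) j /\<^sub>R e) \<le> 1"
        using M that nakano_norm_le_iff[OF diff[OF in_space in_space] \<open>0 < e\<close>]
        unfolding eventually_sequentially by (metis less_le)
    qed simp
    then show ?thesis using nakano_norm_le[OF _ \<open>0 < e\<close>] by blast
  qed
  obtain M where "\<sigma> M - x \<in> nakano_space p" using close[of 1] by auto
  then have "\<sigma> M - (\<sigma> M - x) \<in> nakano_space p" using diff in_space by blast
  then have "x \<in> nakano_space p" by simp
  moreover have "(\<lambda>n. nakano_norm p (\<sigma> n - x)) \<longlonglongrightarrow> 0"
  proof (rule LIMSEQ_I)
    fix e :: real assume "0 < e"
    then obtain M where M: "\<forall>m\<ge>M. nakano_norm p (\<sigma> m - x) \<le> e / 2" using close[of "e / 2"] by auto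
    have "norm (nakano_norm p (\<sigma> m - x) - 0) < e" if "m \<ge> M" for m
    proof -
      have "nakano_norm p (\<sigma> m - x) \<le> e / 2" using M that by blast
      then show ?thesis
        using nakano_norm_nonneg[OF diff[OF in_space \<open>x \<in> nakano_space p\<close>], of m] \<open>0 < e\<close> by simp
    qed
    then show "\<exists>M. \<forall>m\<ge>M. norm (nakano_norm p (\<sigma> m - x) - 0) < e" by blast
  qed
  ultimately show ?thesis by blast
qed

end

section \<open>The unit vector basis and the pair-sum operator\<close>

definition unit_vec :: "nat \<Rightarrow> nat \<Rightarrow> 'k::zero_neq_one" where
  "unit_vec n = (\<lambda>j. if j = n then 1 else 0)"

definition coord_scale :: "'k::times \<Rightarrow> (nat \<Rightarrow> 'k) \<Rightarrow> nat \<Rightarrow> 'k" where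
  "coord_scale a x = (\<lambda>j. a * x j)"

definition pair_partner :: "nat \<Rightarrow> nat" where
  "pair_partner j = (if even j then Suc j else j - 1)"

definition pair_sum :: "(nat \<Rightarrow> 'a::plus) \<Rightarrow> nat \<Rightarrow> 'a" where
  "pair_sum x = (\<lambda>j. x j + x (pair_partner j))"

lemma pair_partner_neq: "pair_partner j \<noteq> j"
  by (auto simp: pair_partner_def elim: oddE)

lemma inj_pair_partner: "inj pair_partner"
proof (rule inj_on_inverseI)
  show "pair_partner (pair_partner j) = j" for j
    by (auto simp: pair_partner_def elim: oddE)
qed

lemma pair_sum_odd: "pair_sum x (Suc (2 * i)) = pair_sum x (2 * i)" for x :: "nat \<Rightarrow> 'a::ab_semigroup_add"
  by (simp add: pair_sum_def pair_partner_def add.commute)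

context nakano
begin

lemma banach_space_nakano:
  "banach_space coord_scale (nakano_space p) (nakano_norm p :: (nat \<Rightarrow> 'k::{real_normed_field,banach}) \<Rightarrow> real)"
proof -
  interpret V: vector_space "coord_scale :: 'k \<Rightarrow> (nat \<Rightarrow> 'k) \<Rightarrow> nat \<Rightarrow> 'k"
    by unfold_locales (simp_all add: coord_scale_def fun_eq_iff algebra_simps)
  have "V.subspace (nakano_space p)"
    unfolding V.subspace_def
    using zero_nakano_space add_nakano_space nakano_norm_scale(1)
    by (auto simp: coord_scale_def)
  then show ?thesis
    by unfold_locales (simp_all add: nakano_norm_nonneg nakano_norm_eq_0_iff nakano_norm_triangle
      nakano_complete coord_scale_def nakano_norm_scale)
qed

text \<open>Choose \<open>F\<close> whose modular is within 1 of the supremum; a disjoint set can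
  add no more than the remaining 1. Applied to \<open>x / e\<close>, this bounds the norm of tails
  of \<open>x\<close> by \<open>e\<close>.\<close>

lemma nakano_tail:
  assumes "x \<in> nakano_space p"
  obtains F where "finite F" "\<And>G. finite G \<Longrightarrow> G \<inter> F = {} \<Longrightarrow> modular p G x \<le> 1"
proof -
  let ?V = "(\<lambda>F. modular p F x) ` {F. finite F}"
  obtain B where "\<And>F. finite F \<Longrightarrow> modular p F x \<le> B"
    using nakano_spaceE[OF assms] by blast
  then have bdd: "bdd_above ?V" unfolding bdd_above_def by blast
  have "Sup ?V - 1 < Sup ?V" by simp
  moreover have "?V \<noteq> {}" by blast
  ultimately obtain v where "v \<in> ?V" "Sup ?V - 1 < v"
    by (metis less_cSup_iff[OF _ bdd])
  then obtain F where F: "finite F" "Sup ?V - 1 < modular p F x"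
    by blast
  show ?thesis
  proof (rule that[OF F(1)])
    fix G assume G: "finite G" "G \<inter> F = {}"
    then have "modular p G x + modular p F x = modular p (G \<union> F) x"
      using F by (simp add: modular_def sum.union_disjoint)
    also have "\<dots> \<le> Sup ?V" using G F by (intro cSup_upper bdd) auto
    finally show "modular p G x \<le> 1" using F by linarith
  qed
qed

lemma sum_unit_vec:
  assumes "finite F"
  shows "(\<Sum>k\<in>F. coord_scale (a k) (unit_vec k)) = (\<lambda>j. if j \<in> F then a j else (0::'k::real_normed_field))"
  using assms
proof (induction F rule: finite_induct)
  case (insert k F)
  have "coord_scale (a k) (unit_vec k) + (\<lambda>j. if j \<in> F then a j else 0)
      = (\<lambda>j. if j \<in> insert k F then a j else 0)"
    using insert.hyps by (intro ext) (auto simp: coord_scale_def unit_vec_def)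
  then show ?case using insert by simp
qed (simp add: zero_fun_def)

lemma finite_support_nakano_space:
  assumes "finite F" "\<And>j. j \<notin> F \<Longrightarrow> x j = 0"
  shows "x \<in> nakano_space p"
proof (rule nakano_spaceI)
  fix G :: "nat set" assume G: "finite G"
  have "modular p G x = modular p (G \<inter> F) x"
    unfolding modular_def using assms G by (intro sum.mono_neutral_right) auto
  also have "\<dots> \<le> modular p F x" using assms by (intro modular_mono_set) auto
  finally show "modular p G x \<le> modular p F x" .
qed

lemma unit_vec_nakano_space: "(unit_vec n :: nat \<Rightarrow> 'k::real_normed_field) \<in> nakano_space p"
  by (rule finite_support_nakano_space[of "{n}"]) (auto simp: unit_vec_def)

lemma nakano_norm_unit_vec: "nakano_norm p (unit_vec n :: nat \<Rightarrow> 'k::real_normed_field) = 1"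
proof (rule antisym)
  show "nakano_norm p (unit_vec n :: nat \<Rightarrow> 'k) \<le> 1"
  proof (rule nakano_norm_le(2))
    fix F :: "nat set" assume "finite F"
    have "modular p F (\<lambda>j. (unit_vec n j :: 'k) /\<^sub>R 1) = (\<Sum>j\<in>F. if j = n then 1 else 0)"
      unfolding modular_def by (intro sum.cong) (auto simp: unit_vec_def)
    then show "modular p F (\<lambda>j. (unit_vec n j :: 'k) /\<^sub>R 1) \<le> 1"
      using \<open>finite F\<close> by simp
  qed simp
  show "1 \<le> nakano_norm p (unit_vec n :: nat \<Rightarrow> 'k)"
    using norm_le_nakano_norm[OF unit_vec_nakano_space, of n n] by (simp add: unit_vec_def)
qed

text \<open>Allowing an arbitrary bijection yields unconditionality; the identity bijection gives
  the ordinary basis expansion.\<close>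

lemma unit_vec_expansion:
  fixes x :: "nat \<Rightarrow> 'k::real_normed_field"
  assumes x: "x \<in> nakano_space p" and "bij \<pi>"
  shows "(\<lambda>m. nakano_norm p ((\<Sum>k<m. coord_scale (x (\<pi> k)) (unit_vec (\<pi> k))) - x)) \<longlonglongrightarrow> 0"
proof -
  define s where "s m = (\<Sum>k<m. coord_scale (x (\<pi> k)) (unit_vec (\<pi> k)))" for m
  have inj: "inj \<pi>" using \<open>bij \<pi>\<close> by (rule bij_is_inj)
  have "s m = (\<Sum>k\<in>\<pi> ` {..<m}. coord_scale (x k) (unit_vec k))" for m
    unfolding s_def using inj by (subst sum.reindex) (auto intro: inj_on_subset)
  then have s: "s m - x = (\<lambda>j. if j \<in> \<pi> ` {..<m} then 0 else - x j)" for m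
    by (simp add: sum_unit_vec fun_eq_iff)
  have in_space: "s m - x \<in> nakano_space p" for m
    by (rule nakano_space_mono[OF x]) (simp add: s)
  have small: "\<exists>M. \<forall>m\<ge>M. nakano_norm p (s m - x) \<le> e" if "0 < e" for e
  proof -
    obtain F where F: "finite F"
      "\<And>G. finite G \<Longrightarrow> G \<inter> F = {} \<Longrightarrow> modular p G (\<lambda>j. x j /\<^sub>R e) \<le> 1"
      using nakano_tail[OF scaleR_nakano_space[OF x]] by blast
    \<comment> \<open>From \<open>M\<close> on, the rearranged partial sums have used every index in
      \<open>F\<close>, so the error lives off \<open>F\<close>.\<close>
    obtain M where M: "inv \<pi> ` F \<subseteq> {..<M}"
      using finite_nat_iff_bounded F(1) by blast
    have "nakano_norm p (s m - x) \<le> e" if "m \<ge> M" for m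
    proof (rule nakano_norm_le(2)[OF _ \<open>0 < e\<close>])
      fix G :: "nat set" assume G: "finite G"
      have "F \<subseteq> \<pi> ` {..<m}"
      proof
        fix j assume "j \<in> F"
        then have "inv \<pi> j < m" using M \<open>m \<ge> M\<close> by force
        moreover have "j = \<pi> (inv \<pi> j)" using \<open>bij \<pi>\<close> by (simp add: bij_is_surj surj_f_inv_f)
        ultimately show "j \<in> \<pi> ` {..<m}" by blast
      qed
      then have disj: "(G - \<pi> ` {..<m}) \<inter> F = {}" by blast
      have "modular p G (\<lambda>j. (s m - x) j /\<^sub>R e) = modular p (G - \<pi> ` {..<m}) (\<lambda>j. x j /\<^sub>R e)"
        unfolding modular_def s using G by (intro sum.mono_neutral_cong_right) auto
      also have "\<dots> \<le> 1" using F(2) disj G by simp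
      finally show "modular p G (\<lambda>j. (s m - x) j /\<^sub>R e) \<le> 1" .
    qed
    then show ?thesis by blast
  qed
  have "(\<lambda>m. nakano_norm p (s m - x)) \<longlonglongrightarrow> 0"
  proof (rule LIMSEQ_I)
    fix e :: real assume "0 < e"
    then obtain M where M: "\<forall>m\<ge>M. nakano_norm p (s m - x) \<le> e / 2"
      using small[of "e / 2"] by auto
    have "norm (nakano_norm p (s m - x) - 0) < e" if "m \<ge> M" for m
    proof -
      have "nakano_norm p (s m - x) \<le> e / 2" using M that by blast
      then show ?thesis using nakano_norm_nonneg[OF in_space, of m] \<open>0 < e\<close> by simp
    qed
    then show "\<exists>M. \<forall>m\<ge>M. norm (nakano_norm p (s m - x) - 0) < e" by blast
  qed
  then show ?thesis by (simp add: s_def)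
qed

text \<open>Coordinates are norm-continuous, and coordinate \<open>j\<close> of the partial sums is
  constantly \<open>a j\<close> once \<open>m > j\<close>.\<close>

lemma unit_vec_expansion_unique:
  fixes x :: "nat \<Rightarrow> 'k::real_normed_field"
  assumes x: "x \<in> nakano_space p"
    and lim: "(\<lambda>m. nakano_norm p ((\<Sum>k<m. coord_scale (a k) (unit_vec k)) - x)) \<longlonglongrightarrow> 0"
  shows "a = x"
proof
  fix j
  define s where "s m = (\<Sum>k<m. coord_scale (a k) (unit_vec k))" for m
  have s: "s m = (\<lambda>j. if j < m then a j else 0)" for m
    by (simp add: s_def sum_unit_vec)
  have "- x \<in> nakano_space p" by (rule nakano_space_mono[OF x]) simp
  moreover have "s m \<in> nakano_space p" for m
    by (rule finite_support_nakano_space[of "{..<m}"]) (auto simp: s)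
  ultimately have in_space: "s m - x \<in> nakano_space p" for m
    using add_nakano_space[of "s m" "- x"] by simp
  have "norm (a j - x j) \<le> 0"
  proof (rule tendsto_lowerbound[where F = sequentially])
    show "(\<lambda>m. nakano_norm p (s m - x)) \<longlonglongrightarrow> 0" using lim by (simp add: s_def)
    have "norm (a j - x j) \<le> nakano_norm p (s m - x)" if "m > j" for m
      using norm_le_nakano_norm[OF in_space, of m j] that by (simp add: s)
    then show "\<forall>\<^sub>F m in sequentially. norm (a j - x j) \<le> nakano_norm p (s m - x)"
      unfolding eventually_sequentially by (metis less_eq_Suc_le)
  qed simp
  then show "a j = x j" by simp
qed

lemma unit_vec_basis:
  fixes b :: "nat \<Rightarrow> nat \<Rightarrow> 'k::{real_normed_field,banach}"
  assumes b: "b = unit_vec"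
  shows "banach_space.unconditional_basis coord_scale (nakano_space p) (nakano_norm p) b"
    and "banach_space.normalized (nakano_norm p) b"
    and "x \<in> nakano_space p \<Longrightarrow> banach_space.coordinate coord_scale (nakano_norm p) b n x = x n"
proof -
  interpret banach_space coord_scale "nakano_space p" "nakano_norm p :: (nat \<Rightarrow> 'k) \<Rightarrow> real"
    by (rule banach_space_nakano)
  have expansion: "series_converges_to (\<lambda>k. coord_scale (x (\<pi> k)) (b (\<pi> k))) x"
    if "x \<in> nakano_space p" "bij \<pi>" for x \<pi>
    unfolding series_converges_to_def b by (rule unit_vec_expansion[OF that])
  have unique: "a = x"
    if "x \<in> nakano_space p" "series_converges_to (\<lambda>k. coord_scale (a k) (b k)) x" for a x
    using unit_vec_expansion_unique that unfolding series_converges_to_def b by blast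
  have coordinate: "coordinate b n x = x n" if "x \<in> nakano_space p" for x n
  proof -
    have "(THE a. series_converges_to (\<lambda>k. coord_scale (a k) (b k)) x) = x"
      using expansion[OF that bij_id] unique[OF that] by (intro the_equality) auto
    then show ?thesis by (simp add: coordinate_def)
  qed
  then show "x \<in> nakano_space p \<Longrightarrow> coordinate b n x = x n" .
  show "normalized b" by (simp add: normalized_def b nakano_norm_unit_vec)
  have "schauder_basis b"
    unfolding schauder_basis_def
  proof (intro conjI ballI allI)
    show "b n \<in> nakano_space p" for n by (simp add: b unit_vec_nakano_space)
    show "\<exists>!a. series_converges_to (\<lambda>k. coord_scale (a k) (b k)) x" if "x \<in> nakano_space p" for x
      using expansion[OF that bij_id] unique[OF that] by (intro ex1I[of _ x]) auto
  qed
  then show "unconditional_basis b"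
    unfolding unconditional_basis_def using expansion coordinate by simp
qed

text \<open>The operator is the identity plus a coordinate permutation, and the permutation
  preserves the norm because paired coordinates have equal exponents.\<close>

lemma pair_sum_bounded:
  assumes p_pair: "\<And>j. p (pair_partner j) = p j" and x: "x \<in> nakano_space p"
  shows "pair_sum x \<in> nakano_space p" "nakano_norm p (pair_sum x) \<le> 2 * nakano_norm p x"
proof -
  let ?y = "\<lambda>j. x (pair_partner j)"
  have reindex: "modular p F (\<lambda>j. x (pair_partner j) /\<^sub>R t) = modular p (pair_partner ` F) (\<lambda>j. x j /\<^sub>R t)"
    for F t
    unfolding modular_def
    by (subst sum.reindex) (auto intro: inj_on_subset[OF inj_pair_partner] simp: p_pair)
  have le: "?y \<in> nakano_space p \<and> nakano_norm p ?y \<le> t" if "nakano_norm p x < t" for t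
  proof -
    have "0 < t" using that nakano_norm_nonneg[OF x] by linarith
    have "modular p F (\<lambda>j. ?y j /\<^sub>R t) \<le> 1" if "finite F" for F
      using nakano_norm_le_iff[OF x \<open>0 < t\<close>] \<open>nakano_norm p x < t\<close> that by (simp add: reindex)
    then show ?thesis using nakano_norm_le[of t ?y] \<open>0 < t\<close> by blast
  qed
  have y: "?y \<in> nakano_space p" using le[of "nakano_norm p x + 1"] by simp
  have "nakano_norm p ?y \<le> nakano_norm p x" by (rule dense_ge) (use le in simp)
  moreover have "pair_sum x = x + ?y" by (simp add: pair_sum_def fun_eq_iff)
  ultimately show "pair_sum x \<in> nakano_space p" "nakano_norm p (pair_sum x) \<le> 2 * nakano_norm p x"
    using add_nakano_space[OF x y] nakano_norm_triangle[OF x y] by auto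
qed

end

section \<open>Orthogonal projections and random signs\<close>

text \<open>\<open>Q\<close> is the matrix of the orthogonal projection onto the common kernel of the functionals \<open>a l\<close>,
  \<open>l < r\<close>.\<close>

lemma kernel_projection:
  fixes a :: "nat \<Rightarrow> 'i \<Rightarrow> real"
  assumes "finite I"
  shows "\<exists>Q. (\<forall>i j. Q i j = Q j i) \<and> (\<forall>i\<in>I. \<forall>j\<in>I. (\<Sum>k\<in>I. Q i k * Q k j) = Q i j) \<and>
    (\<forall>l<r. \<forall>j\<in>I. (\<Sum>i\<in>I. a l i * Q i j) = 0) \<and> real (card I) - real r \<le> (\<Sum>i\<in>I. Q i i)"
proof (induction r)
  case 0
  have "(\<Sum>k\<in>I. of_bool (i = k) * of_bool (k = j)) = (of_bool (i = j) :: real)" if "i \<in> I" for i j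
  proof -
    have "(\<Sum>k\<in>I. of_bool (i = k) * of_bool (k = j))
        = (\<Sum>k\<in>I. if i = k then of_bool (i = j) else 0 :: real)"
      by (intro sum.cong) auto
    then show ?thesis using assms that by simp
  qed
  then show ?case
    by (intro exI[of _ "\<lambda>i j. of_bool (i = j)"]) auto
next
  case (Suc r)
  then obtain Q where sym: "\<And>i j. Q i j = Q j i"
    and idem: "\<And>i j. i \<in> I \<Longrightarrow> j \<in> I \<Longrightarrow> (\<Sum>k\<in>I. Q i k * Q k j) = Q i j"
    and ker: "\<And>l j. l < r \<Longrightarrow> j \<in> I \<Longrightarrow> (\<Sum>i\<in>I. a l i * Q i j) = 0"
    and tr: "real (card I) - real r \<le> (\<Sum>i\<in>I. Q i i)"
    by blast
  \<comment> \<open>The vector \<open>v\<close> is the projection \<open>Q\<close> applied to the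
    new functional, and \<open>c\<close> is its squared length.\<close>
  define v where "v i = (\<Sum>k\<in>I. Q i k * a r k)" for i
  define c where "c = (\<Sum>i\<in>I. v i * v i)"
  have aQ: "(\<Sum>i\<in>I. a r i * Q i j) = v j" for j
    unfolding v_def by (intro sum.cong refl) (metis sym mult.commute)
  have Qv: "(\<Sum>k\<in>I. Q i k * v k) = v i" if "i \<in> I" for i
  proof -
    have "(\<Sum>k\<in>I. Q i k * v k) = (\<Sum>k\<in>I. \<Sum>m\<in>I. Q i k * Q k m * a r m)"
      by (simp add: v_def sum_distrib_left mult.assoc)
    also have "\<dots> = (\<Sum>m\<in>I. (\<Sum>k\<in>I. Q i k * Q k m) * a r m)"
      by (subst sum.swap) (simp add: sum_distrib_right)
    also have "\<dots> = v i" using that by (simp add: idem v_def)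
    finally show ?thesis .
  qed
  have vQ: "(\<Sum>k\<in>I. v k * Q k i) = v i" if "i \<in> I" for i
    using Qv[OF that] by (metis (no_types, lifting) sum.cong sym mult.commute)
  have av: "(\<Sum>i\<in>I. a r i * v i) = c"
  proof -
    have "c = (\<Sum>i\<in>I. \<Sum>k\<in>I. a r k * Q k i * v i)"
      unfolding c_def by (intro sum.cong refl) (simp flip: aQ add: sum_distrib_right)
    also have "\<dots> = (\<Sum>k\<in>I. a r k * (\<Sum>i\<in>I. Q k i * v i))"
      by (subst sum.swap) (simp add: sum_distrib_left mult.assoc)
    also have "\<dots> = (\<Sum>i\<in>I. a r i * v i)" by (simp add: Qv)
    finally show ?thesis by simp
  qed
  have alv: "(\<Sum>i\<in>I. a l i * v i) = 0" if "l < r" for l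
  proof -
    have "(\<Sum>i\<in>I. a l i * v i) = (\<Sum>i\<in>I. \<Sum>k\<in>I. a l i * Q i k * a r k)"
      by (simp add: v_def sum_distrib_left mult.assoc)
    also have "\<dots> = (\<Sum>k\<in>I. (\<Sum>i\<in>I. a l i * Q i k) * a r k)"
      by (subst sum.swap) (simp add: sum_distrib_right)
    finally show ?thesis using that by (simp add: ker)
  qed
  show ?case
  proof (cases "c = 0")
    case True
    \<comment> \<open>The new functional already vanishes on the range of \<open>Q\<close>, so
      \<open>Q\<close> can be kept.\<close>
    then have "v i = 0" if "i \<in> I" for i
      using that assms unfolding c_def by (subst (asm) sum_nonneg_eq_0_iff) auto
    then show ?thesis
      using sym idem ker tr aQ by (intro exI[of _ Q]) (auto simp: less_Suc_eq)
  next
    case False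
    \<comment> \<open>Subtracting the projection onto the line through \<open>v\<close> restricts
      the range to the new kernel and lowers the trace by exactly 1.\<close>
    define Q' where "Q' i j = Q i j - v i * v j / c" for i j
    have "(\<Sum>k\<in>I. Q' i k * Q' k j) = Q' i j" if "i \<in> I" "j \<in> I" for i j
    proof -
      have "(\<Sum>k\<in>I. Q' i k * Q' k j)
        = (\<Sum>k\<in>I. Q i k * Q k j - (Q i k * v k) * (v j / c) - (v k * Q k j) * (v i / c)
            + (v k * v k) * (v i * v j / c / c))"
        unfolding Q'_def by (intro sum.cong refl) (simp add: algebra_simps)
      also have "\<dots> = Q i j - v i * (v j / c) - v j * (v i / c) + c * (v i * v j / c / c)"
        by (simp only: sum.distrib sum_subtractf sum_distrib_right[symmetric] idem[OF that]
          Qv[OF that(1)] vQ[OF that(2)] c_def[symmetric])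
      also have "\<dots> = Q' i j" using False by (simp add: Q'_def)
      finally show ?thesis .
    qed
    moreover have "(\<Sum>i\<in>I. a l i * Q' i j) = 0" if "l < Suc r" "j \<in> I" for l j
    proof -
      have "(\<Sum>i\<in>I. a l i * Q' i j) = (\<Sum>i\<in>I. a l i * Q i j) - (\<Sum>i\<in>I. a l i * v i) * (v j / c)"
        by (simp add: Q'_def right_diff_distrib sum_subtractf sum_distrib_right mult.assoc
            sum_divide_distrib)
      then show ?thesis
        using that False ker alv av aQ by (cases "l = r") (auto simp: less_Suc_eq)
    qed
    moreover have "(\<Sum>i\<in>I. Q' i i) = (\<Sum>i\<in>I. Q i i) - 1"
      using False by (simp add: Q'_def sum_subtractf c_def flip: sum_divide_distrib)
    moreover have "Q' i j = Q' j i" for i j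
      by (simp add: Q'_def sym[of i j])
    ultimately show ?thesis using tr by (intro exI[of _ Q']) auto
  qed
qed

text \<open>The average of \<open>f (v + \<epsilon>\<^sub>0 x 0 + \<dots> + \<epsilon>\<^sub>m x m)\<close>, \<open>m = n - 1\<close>, over all choices of signs \<open>\<epsilon>\<^sub>i = \<plusminus>1\<close>.\<close>

primrec signavg :: "nat \<Rightarrow> (nat \<Rightarrow> 'v::ab_group_add) \<Rightarrow> ('v \<Rightarrow> real) \<Rightarrow> 'v \<Rightarrow> real" where
  "signavg 0 x f v = f v"
| "signavg (Suc n) x f v = (signavg n x f (v + x n) + signavg n x f (v - x n)) / 2"

section \<open>Averages over random signs\<close>

lemma signavg_mono:
  assumes "\<And>u w. u \<in> U \<Longrightarrow> w \<in> U \<Longrightarrow> u + w \<in> U \<and> u - w \<in> U"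
    and "\<And>i. i < n \<Longrightarrow> x i \<in> U" "\<And>u. u \<in> U \<Longrightarrow> f u \<le> g u" "v \<in> U"
  shows "signavg n x f v \<le> signavg n x g v"
  using assms(2,4)
proof (induction n arbitrary: v)
  case (Suc n)
  then have "signavg n x f (v + x n) \<le> signavg n x g (v + x n)"
    "signavg n x f (v - x n) \<le> signavg n x g (v - x n)"
    using assms(1)[of v "x n"] by auto
  then show ?case by simp
qed (use assms(3) in simp)

text \<open>As in \<open>signavg_mono\<close>, the set \<open>U\<close> confines all signed sums to
  a domain on which the pointwise facts hold; here \<open>L\<close> need be additive only
  there.\<close>

lemma signavg_comp:
  assumes "\<And>u w. u \<in> U \<Longrightarrow> w \<in> U \<Longrightarrow> u + w \<in> U \<and> u - w \<in> U"
    and "\<And>i. i < n \<Longrightarrow> x i \<in> U" "v \<in> U"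
    and "\<And>u w. u \<in> U \<Longrightarrow> w \<in> U \<Longrightarrow> L (u + w) = L u + L w \<and> L (u - w) = L u - L w"
  shows "signavg n x (\<lambda>u. f (L u)) v = signavg n (\<lambda>i. L (x i)) f (L v)"
  using assms(2,3)
proof (induction n arbitrary: v)
  case (Suc n)
  then show ?case using assms(1)[of v "x n"] assms(4)[of v "x n"] by simp
qed simp

lemma signavg_coordinate:
  "signavg n x (\<lambda>u. f (u j)) v = signavg n (\<lambda>i. x i j) f (v j)"
  using signavg_comp[of UNIV n x v "\<lambda>u. u j"] by simp

lemma signavg_const: "signavg n x (\<lambda>u. c) v = c"
  by (induction n arbitrary: v) auto

lemma signavg_add: "signavg n x (\<lambda>u. f u + g u) v = signavg n x f v + signavg n x g v"
  by (induction n arbitrary: v) (auto simp: field_simps)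

lemma signavg_cmult: "signavg n x (\<lambda>u. c * f u) v = c * signavg n x f v"
  by (induction n arbitrary: v) (auto simp: field_simps)

lemma signavg_sum: "finite F \<Longrightarrow> signavg n x (\<lambda>u. \<Sum>j\<in>F. f j u) v = (\<Sum>j\<in>F. signavg n x (f j) v)"
  by (induction F rule: finite_induct) (auto simp: signavg_add signavg_const)

text \<open>Iterate \<open>powr_two_point\<close>, one sign at a time. The free starting point
  \<open>v\<close> makes the induction work.\<close>

lemma signavg_powr_ge:
  fixes x :: "nat \<Rightarrow> 'a::real_inner"
  assumes "2 \<le> q"
  shows "norm v powr q + (\<Sum>i<n. norm (x i) powr q) \<le> signavg n x (\<lambda>u. norm u powr q) v"
proof (induction n arbitrary: v)
  case (Suc n)
  show ?case
    using Suc[of "v + x n"] Suc[of "v - x n"] powr_two_point[OF assms, of v "x n"]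
    by (simp add: field_simps)
qed simp

text \<open>This is Khintchine's inequality for the fourth moment, with constant 3; the terms in
  \<open>v\<close> carry the induction.\<close>

lemma signavg_power4_le:
  fixes x :: "nat \<Rightarrow> 'a::real_inner"
  shows "signavg n x (\<lambda>u. norm u ^ 4) v
    \<le> norm v ^ 4 + 6 * (norm v)\<^sup>2 * (\<Sum>i<n. (norm (x i))\<^sup>2) + 3 * (\<Sum>i<n. (norm (x i))\<^sup>2)\<^sup>2"
proof (induction n arbitrary: v)
  case (Suc n)
  define s a b c where "s = (\<Sum>i<n. (norm (x i))\<^sup>2)" and "a = (norm v)\<^sup>2" and "b = (norm (x n))\<^sup>2"
    and "c = v \<bullet> x n"
  have nonneg: "0 \<le> s" "0 \<le> a" "0 \<le> b" by (simp_all add: s_def a_def b_def sum_nonneg)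
  have cs: "c\<^sup>2 \<le> a * b"
    using Cauchy_Schwarz_ineq[of v "x n"] by (simp add: a_def b_def c_def power2_norm_eq_inner)
  have plus: "(norm (v + x n))\<^sup>2 = a + b + 2 * c" and minus: "(norm (v - x n))\<^sup>2 = a + b - 2 * c"
    by (simp_all add: a_def b_def c_def power2_norm_eq_inner inner_simps inner_commute)
  have p4: "norm y ^ 4 = ((norm y)\<^sup>2)\<^sup>2" for y :: 'a by (simp flip: power_mult)
  have "signavg (Suc n) x (\<lambda>u. norm u ^ 4) v
    \<le> (((a + b + 2 * c)\<^sup>2 + 6 * (a + b + 2 * c) * s + 3 * s\<^sup>2)
        + ((a + b - 2 * c)\<^sup>2 + 6 * (a + b - 2 * c) * s + 3 * s\<^sup>2)) / 2"
    using Suc[of "v + x n"] Suc[of "v - x n"]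
    unfolding signavg.simps p4 plus minus s_def[symmetric]
    by (intro divide_right_mono add_mono) (auto simp only: zero_le_numeral)
  also have "\<dots> = (a + b)\<^sup>2 + 4 * c\<^sup>2 + 6 * (a + b) * s + 3 * s\<^sup>2"
    by (simp add: power2_eq_square algebra_simps add_divide_distrib diff_divide_distrib)
  \<comment> \<open>Cauchy-Schwarz replaces \<open>c\<^sup>2\<close> by \<open>a * b\<close>, and
    the added \<open>2 * b\<^sup>2\<close> completes the square
    \<open>3 * (s + b)\<^sup>2\<close>.\<close>
  also have "\<dots> \<le> (a + b)\<^sup>2 + 4 * (a * b) + 6 * (a + b) * s + 3 * s\<^sup>2 + 2 * b\<^sup>2"
    using cs zero_le_power2[of b] by linarith
  also have "\<dots> = a\<^sup>2 + 6 * a * (s + b) + 3 * (s + b)\<^sup>2"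
    by (simp add: power2_eq_square algebra_simps)
  finally show ?case unfolding p4 s_def a_def b_def by simp
qed simp

lemma signavg_powr_coordinate:
  fixes x :: "nat \<Rightarrow> 'j \<Rightarrow> 'a::real_normed_vector"
  shows "signavg n x (\<lambda>u. norm (u j) powr r) 0 = signavg n (\<lambda>i. x i j) (\<lambda>z. norm z powr r) 0"
  using signavg_coordinate[of n x "\<lambda>z. norm z powr r" j 0] by simp

section \<open>Modular estimates and the bound for a single block\<close>

context nakano
begin

lemma modular_signavg_ge:
  fixes x :: "nat \<Rightarrow> nat \<Rightarrow> 'a::real_inner"
  assumes "finite F"
  shows "(\<Sum>i<n. modular p F (x i)) \<le> signavg n x (modular p F) 0"
proof -
  have "(\<Sum>i<n. modular p F (x i)) = (\<Sum>j\<in>F. \<Sum>i<n. norm (x i j) powr p j)"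
    unfolding modular_def by (rule sum.swap)
  also have "\<dots> \<le> (\<Sum>j\<in>F. signavg n (\<lambda>i. x i j) (\<lambda>z. norm z powr p j) 0)"
  proof (rule sum_mono)
    show "(\<Sum>i<n. norm (x i j) powr p j) \<le> signavg n (\<lambda>i. x i j) (\<lambda>z. norm z powr p j) 0" for j
      using signavg_powr_ge[OF p_ge2, where v = 0 and n = n and x = "\<lambda>i. x i j" and j1 = j] p_ge2[of j] by simp
  qed
  also have "\<dots> = signavg n x (modular p F) 0"
    unfolding modular_def
    by (subst signavg_sum[OF assms]) (simp add: signavg_powr_coordinate)
  finally show ?thesis .
qed

text \<open>Since exponents are at most 4, each power is at most 1 plus the fourth power, whose
  average is at most \<open>3 * s\<^sup>2\<close>. The constant exponent on \<open>F\<close> lets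
  \<open>\<mu>\<close> be pulled out.\<close>

lemma modular_signavg_le:
  fixes x :: "nat \<Rightarrow> nat \<Rightarrow> 'a::real_inner" and s :: real
  assumes "finite F" and p_F: "\<And>j. j \<in> F \<Longrightarrow> p j = P"
    and sq: "\<And>j. j \<in> F \<Longrightarrow> (\<Sum>i<n. (norm (x i j))\<^sup>2) \<le> s"
  shows "signavg n (\<lambda>i j. \<mu> *\<^sub>R x i j) (modular p F) 0 \<le> \<bar>\<mu>\<bar> powr P * (card F * (1 + 3 * s\<^sup>2))"
proof -
  let ?L = "\<lambda>u j. \<mu> *\<^sub>R u j :: 'a"
  have coord: "signavg n (\<lambda>i. x i j) (\<lambda>z. norm z powr p j) 0 \<le> 1 + 3 * s\<^sup>2" if "j \<in> F" for j
  proof -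
    have le: "norm z powr p j \<le> 1 + norm z ^ 4" for z :: 'a
    proof (cases "norm z \<le> 1")
      case True
      then have "norm z powr p j \<le> 1" using p_ge2[of j] by (intro powr_le1) auto
      then show ?thesis by (simp add: add_increasing2)
    next
      case False
      then have "norm z powr p j \<le> norm z powr 4" using p_le4[of j] by (intro powr_mono) auto
      then show ?thesis by simp
    qed
    have "signavg n (\<lambda>i. x i j) (\<lambda>z. norm z powr p j) 0 \<le> signavg n (\<lambda>i. x i j) (\<lambda>z. 1 + norm z ^ 4) 0"
      by (rule signavg_mono[where U = UNIV]) (simp_all add: le)
    also have "\<dots> \<le> 1 + 3 * (\<Sum>i<n. (norm (x i j))\<^sup>2)\<^sup>2"
      using signavg_power4_le[of n "\<lambda>i. x i j" 0] by (simp add: signavg_add signavg_const)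
    also have "\<dots> \<le> 1 + 3 * s\<^sup>2"
      using sq[OF that] by (simp add: power_mono sum_nonneg)
    finally show ?thesis .
  qed
  have L0: "?L 0 = 0" by (simp add: fun_eq_iff)
  have "signavg n (\<lambda>i. ?L (x i)) (modular p F) 0 = signavg n x (\<lambda>u. modular p F (?L u)) 0"
    using signavg_comp[of UNIV n x 0 ?L "modular p F"]
    unfolding L0 by (simp add: fun_eq_iff scaleR_right_distrib scaleR_right_diff_distrib)
  also have "(\<lambda>u. modular p F (?L u)) = (\<lambda>u. \<Sum>j\<in>F. \<bar>\<mu>\<bar> powr P * norm (u j) powr p j)"
    unfolding modular_scale by (intro ext sum.cong) (auto simp: p_F)
  also have "signavg n x \<dots> 0
      = (\<Sum>j\<in>F. \<bar>\<mu>\<bar> powr P * signavg n (\<lambda>i. x i j) (\<lambda>z. norm z powr p j) 0)"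
    by (subst signavg_sum[OF assms(1)]) (simp add: signavg_cmult signavg_powr_coordinate)
  also have "\<dots> \<le> (\<Sum>j\<in>F. \<bar>\<mu>\<bar> powr P * (1 + 3 * s\<^sup>2))"
    using coord by (intro sum_mono mult_left_mono) auto
  also have "\<dots> = \<bar>\<mu>\<bar> powr P * (card F * (1 + 3 * s\<^sup>2))" by simp
  finally show ?thesis .
qed

text \<open>Turns a norm bound into a modular bound. With constant exponent \<open>P\<close> on the
  support of \<open>u\<close>, the norm of \<open>u\<close> is at most the modular to the power
  \<open>1 / P\<close>; exponents at most \<open>P\<close> on \<open>F\<close> convert back.\<close>

lemma modular_image_le:
  fixes u :: "nat \<Rightarrow> 'a::real_normed_vector" and v :: "nat \<Rightarrow> 'b::real_normed_vector"
  assumes "finite B" and p_B: "\<And>j. j \<in> B \<Longrightarrow> p j = P" and supp: "\<And>j. j \<notin> B \<Longrightarrow> u j = 0"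
    and "2 \<le> P" "P \<le> 4"
    and v: "v \<in> nakano_space p" "nakano_norm p v \<le> C * nakano_norm p u" and "1 \<le> C"
    and "finite F" and p_F: "\<And>j. j \<in> F \<Longrightarrow> p j \<le> P"
  shows "modular p F v \<le> 1 + C ^ 4 * modular p B u"
proof -
  define m where "m = modular p B u"
  have u: "u \<in> nakano_space p" by (rule finite_support_nakano_space[OF assms(1) supp])
  have m: "0 \<le> m" by (simp add: m_def modular_nonneg)
  have norm_u: "nakano_norm p u \<le> m powr (1 / P)"
  proof (cases "m = 0")
    case True
    then have "\<forall>j\<in>B. norm (u j) powr p j = 0"
      using assms(1) unfolding m_def modular_def by (subst (asm) sum_nonneg_eq_0_iff) auto
    then have "u = 0" using supp by (auto simp: fun_eq_iff)
    then show ?thesis by (simp add: nakano_norm_zero)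
  next
    case False
    define s where "s = m powr (1 / P)"
    have s: "0 < s" "s powr P = m" using False m \<open>2 \<le> P\<close> by (auto simp: s_def powr_powr)
    have "modular p G (\<lambda>j. u j /\<^sub>R s) \<le> 1" if "finite G" for G
    proof -
      have "modular p G (\<lambda>j. u j /\<^sub>R s) = modular p (G \<inter> B) (\<lambda>j. u j /\<^sub>R s)"
        unfolding modular_def using that supp by (intro sum.mono_neutral_right) auto
      also have "\<dots> \<le> modular p B (\<lambda>j. u j /\<^sub>R s)"
        using assms(1) by (intro modular_mono_set) auto
      also have "\<dots> \<le> inverse s powr P * m"
        unfolding m_def using s p_B by (intro modular_scale_le) auto
      also have "inverse s powr P = inverse m"
        using s by (simp add: inverse_powr)
      finally show ?thesis using False by simp
    qed
    then show ?thesis using nakano_norm_le(2)[OF _ s(1)] unfolding s_def by blast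
  qed
  define t where "t = C * m powr (1 / P)"
  have norm_v: "nakano_norm p v \<le> t"
    using v(2) norm_u \<open>1 \<le> C\<close> unfolding t_def by (meson mult_left_mono order_trans zero_le_one)
  show ?thesis
  \<comment> \<open>For \<open>t <= 1\<close> smaller exponents give larger powers of
    \<open>t\<close>, so only the bound 1 is available; this is the summand 1 of the claim.\<close>
  proof (cases "t \<le> 1")
    case True
    then have "modular p F (\<lambda>j. v j /\<^sub>R 1) \<le> 1"
      using nakano_norm_le_iff[OF v(1), of 1] norm_v \<open>finite F\<close> by simp
    then show ?thesis using m \<open>1 \<le> C\<close> by (simp add: add_increasing2 flip: m_def)
  next
    case False
    then have "modular p F (\<lambda>j. v j /\<^sub>R t) \<le> 1"
      using nakano_norm_le_iff[OF v(1), of t] norm_v \<open>finite F\<close> by simp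
    moreover have "modular p F (\<lambda>j. t *\<^sub>R (v j /\<^sub>R t)) \<le> t powr P * modular p F (\<lambda>j. v j /\<^sub>R t)"
      using False p_F by (intro modular_scale_le) (auto intro: powr_mono)
    moreover have "t powr P * modular p F (\<lambda>j. v j /\<^sub>R t) \<le> t powr P"
      using calculation(1) by (intro mult_left_le) auto
    moreover have "(\<lambda>j. t *\<^sub>R (v j /\<^sub>R t)) = v" using False by (simp add: fun_eq_iff)
    moreover have "t powr P = C powr P * m"
      using m \<open>1 \<le> C\<close> \<open>2 \<le> P\<close> by (simp add: t_def powr_mult powr_powr)
    moreover have "C powr P \<le> C ^ 4"
      using powr_mono[of P 4 C] \<open>1 \<le> C\<close> \<open>P \<le> 4\<close> by simp
    then have "C powr P * m \<le> C ^ 4 * m" using m by (rule mult_right_mono)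
    ultimately have "modular p F v \<le> C ^ 4 * m" by simp
    then show ?thesis by (simp add: m_def)
  qed
qed

text \<open>A norm above \<open>c\<close> makes the modular of \<open>v / c\<close> exceed 1 on some
  finite set; as \<open>c <= 1\<close> and exponents are at most \<open>q\<close>, undoing the
  division costs at most \<open>c powr q\<close>. The alternative \<open>c = 0\<close> serves
  vanishing projections.\<close>

lemma exists_modular_ge:
  assumes v: "v \<in> nakano_space p" and c: "0 \<le> c" "c \<le> 1" "c < nakano_norm p v \<or> c = 0"
    and supp: "\<And>j. j \<notin> B \<Longrightarrow> v j = 0" and p_B: "\<And>j. j \<in> B \<Longrightarrow> p j \<le> q"
  shows "\<exists>F. finite F \<and> F \<subseteq> B \<and> c powr q \<le> modular p F v"
proof (cases "c = 0")
  case True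
  then show ?thesis by (intro exI[of _ "{}"]) (simp add: modular_def)
next
  case False
  then have "0 < c" "\<not> nakano_norm p v \<le> c" using c by auto
  then obtain G where G: "finite G" "1 < modular p G (\<lambda>j. v j /\<^sub>R c)"
    using nakano_norm_le_iff[OF v \<open>0 < c\<close>] by (meson not_le)
  have "modular p G (\<lambda>j. v j /\<^sub>R c) = modular p (G \<inter> B) (\<lambda>j. v j /\<^sub>R c)"
    unfolding modular_def using G supp by (intro sum.mono_neutral_right) auto
  also have "\<dots> \<le> inverse (c powr q) * modular p (G \<inter> B) v"
  proof (rule modular_scale_le)
    fix j assume "j \<in> G \<inter> B"
    then have "c powr q \<le> c powr p j" using p_B c by (intro powr_mono') auto
    then show "\<bar>inverse c\<bar> powr p j \<le> inverse (c powr q)"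
      using \<open>0 < c\<close> by (simp add: inverse_powr le_imp_inverse_le)
  qed
  finally have "1 < inverse (c powr q) * modular p (G \<inter> B) v" using G by simp
  then have "c powr q \<le> modular p (G \<inter> B) v" using \<open>0 < c\<close> by (simp add: field_simps)
  then show ?thesis using G(1) by (intro exI[of _ "G \<inter> B"]) auto
qed

text \<open>The quantitative core: \<open>C\<close> bounds both \<open>A\<close> and its inverse on
  the image, and the resulting bound does not depend on the block. Blocks with unbounded left-hand
  side therefore rule out such an \<open>A\<close>.\<close>

lemma block_bound:
  fixes A :: "(nat \<Rightarrow> 'k::{real_normed_field,euclidean_space}) \<Rightarrow> nat \<Rightarrow> 'k"
  assumes A_space: "\<And>x. x \<in> nakano_space p \<Longrightarrow> A x \<in> nakano_space p"
    and A_add: "\<And>x y. x \<in> nakano_space p \<Longrightarrow> y \<in> nakano_space p \<Longrightarrow> A (x + y) = A x + A y"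
    and A_scale: "\<And>c x. x \<in> nakano_space p \<Longrightarrow> A (\<lambda>j. c *\<^sub>R x j) = (\<lambda>j. c *\<^sub>R A x j)"
    and A_le: "\<And>x. x \<in> nakano_space p \<Longrightarrow> nakano_norm p (A x) \<le> C * nakano_norm p x"
    and A_ge: "\<And>x. x \<in> nakano_space p \<Longrightarrow> nakano_norm p x \<le> C * nakano_norm p (A x)"
    and A_pair: "\<And>x i. x \<in> nakano_space p \<Longrightarrow> A x (Suc (2 * i)) = A x (2 * i)"
    and "1 \<le> C" and "4 * a \<le> b" "0 < b" "even b"
    and p_block: "\<And>j. a \<le> j \<Longrightarrow> j < b \<Longrightarrow> p j = P" and p_above: "\<And>j. b \<le> j \<Longrightarrow> p j \<le> q"
    and "2 \<le> q" "q \<le> P" "P \<le> 4"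
  shows "real (b - a) powr (1 - q / P) \<le> 4096 * C ^ 4 * (1 + C ^ 4 * (1 + 3 * (real DIM('k))\<^sup>2))"
proof -
  define d where "d = DIM('k)"
  define N where "N = b - a"
  \<comment> \<open>Scalars are split into real coordinates, so that real and complex spaces are
    treated alike by real matrices.\<close>
  define I where "I = {a..<b} \<times> (Basis :: 'k set)"
  \<comment> \<open>The number of real conditions that make \<open>A x\<close> vanish below
    \<open>b\<close>: by \<open>A_pair\<close> the even coordinates suffice.\<close>
  define r where "r = (b div 2) * d"
  \<comment> \<open>Chosen so that \<open>N * \<mu> powr P = 1\<close>, which keeps the average
    modular of the signed sums bounded.\<close>
  define \<mu> where "\<mu> = real N powr (- 1 / P)"
  define single :: "nat \<times> 'k \<Rightarrow> nat \<Rightarrow> 'k" where "single s = (\<lambda>j. if j = fst s then snd s else 0)" for s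
  have N: "0 < N" "2 * N \<ge> b" using assms(8,9) by (auto simp: N_def)
  have d: "0 < d" by (simp add: d_def)
  have fin: "finite I" by (simp add: I_def)
  have card_I: "card I = N * d" by (simp add: I_def N_def d_def card_cartesian_product)
  have \<mu>: "0 < \<mu>" "\<mu> \<le> 1" "\<mu> powr P = 1 / real N" "real N * \<mu> powr q = real N powr (1 - q / P)"
  proof -
    show "0 < \<mu>" using N by (simp add: \<mu>_def)
    show "\<mu> \<le> 1"
      using powr_mono[of "- 1 / P" 0 "real N"] N \<open>2 \<le> q\<close> \<open>q \<le> P\<close> by (simp add: \<mu>_def)
    show "\<mu> powr P = 1 / real N"
      using N \<open>2 \<le> q\<close> \<open>q \<le> P\<close> by (simp add: \<mu>_def powr_powr powr_neg_one)
    have "real N * \<mu> powr q = real N powr 1 * real N powr (- q / P)"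
      using N by (simp add: \<mu>_def powr_powr)
    also have "\<dots> = real N powr (1 - q / P)" by (simp only: powr_add[symmetric] minus_divide_left[symmetric] diff_conv_add_uminus)
    finally show "real N * \<mu> powr q = real N powr (1 - q / P)" .
  qed
  have single_space: "single s \<in> nakano_space p" for s
    by (rule finite_support_nakano_space[of "{fst s}"]) (auto simp: single_def)

  have "\<exists>g. bij_betw g {..<r} ({..<b div 2} \<times> (Basis :: 'k set))"
  proof -
    have "card ({..<b div 2} \<times> (Basis :: 'k set)) = r"
      by (simp add: r_def d_def card_cartesian_product)
    then show ?thesis
      using ex_bij_betw_nat_finite[of "{..<b div 2} \<times> (Basis :: 'k set)"] by (simp add: atLeast0LessThan)
  qed
  then obtain g where g: "bij_betw g {..<r} ({..<b div 2} \<times> (Basis :: 'k set))" by blast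
  obtain Q where Q_sym: "\<And>s t. Q s t = Q t s"
    and Q_idem: "\<And>s t. s \<in> I \<Longrightarrow> t \<in> I \<Longrightarrow> (\<Sum>k\<in>I. Q s k * Q k t) = Q s t"
    and Q_ker: "\<And>l t. l < r \<Longrightarrow> t \<in> I \<Longrightarrow>
      (\<Sum>s\<in>I. (A (single s) (2 * fst (g l)) \<bullet> snd (g l)) * Q s t) = 0"
    and Q_trace: "real (card I) - real r \<le> (\<Sum>s\<in>I. Q s s)"
    using kernel_projection[OF fin, of r "\<lambda>l s. A (single s) (2 * fst (g l)) \<bullet> snd (g l)"] by blast
  have Q_diag: "(\<Sum>t\<in>I. (Q s t)\<^sup>2) = Q s s" if "s \<in> I" for s
  proof -
    have "(Q s t)\<^sup>2 = Q s t * Q t s" for t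
      unfolding power2_eq_square using Q_sym[of t s] by simp
    then show ?thesis using Q_idem[OF that that] by simp
  qed
  have Q01: "0 \<le> Q s s \<and> Q s s \<le> 1" if "s \<in> I" for s
  proof -
    have "(Q s s)\<^sup>2 \<le> (\<Sum>t\<in>I. (Q s t)\<^sup>2)" using that fin by (intro member_le_sum) auto
    then have "(Q s s)\<^sup>2 \<le> Q s s" using Q_diag[OF that] by simp
    moreover have "0 \<le> (Q s s)\<^sup>2" by simp
    ultimately show ?thesis by (auto simp: power2_eq_square mult_le_cancel_right2)
  qed

  \<comment> \<open>The image of the basis vector \<open>t\<close> under the projection \<open>Q\<close>.\<close>
  define w where "w t = (\<lambda>j. \<Sum>s\<in>I. Q s t *\<^sub>R single s j)" for t
  have A_sum: "(\<lambda>j. \<Sum>s\<in>J. c s *\<^sub>R single s j) \<in> nakano_space p \<and>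
      A (\<lambda>j. \<Sum>s\<in>J. c s *\<^sub>R single s j) = (\<lambda>j. \<Sum>s\<in>J. c s *\<^sub>R A (single s) j)"
    if "finite J" for J c
    using that
  proof (induction J rule: finite_induct)
    case empty
    have "A (\<lambda>j. 0 *\<^sub>R single undefined j) = (\<lambda>j. 0 *\<^sub>R A (single undefined) j)"
      by (rule A_scale[OF single_space])
    then show ?case using zero_nakano_space by (simp add: zero_fun_def)
  next
    case (insert s J)
    have split: "(\<lambda>j. \<Sum>s\<in>insert s J. c s *\<^sub>R u s j)
        = (\<lambda>j. c s *\<^sub>R u s j) + (\<lambda>j. \<Sum>s\<in>J. c s *\<^sub>R u s j)" for u :: "nat \<times> 'k \<Rightarrow> nat \<Rightarrow> 'k"
      using insert.hyps by (simp add: fun_eq_iff)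
    have s: "(\<lambda>j. c s *\<^sub>R single s j) \<in> nakano_space p"
      by (rule scaleR_nakano_space[OF single_space])
    have J: "(\<lambda>j. \<Sum>s\<in>J. c s *\<^sub>R single s j) \<in> nakano_space p" using insert.IH by blast
    show ?case
      unfolding split using add_nakano_space[OF s J] A_add[OF s J] insert.IH A_scale[OF single_space]
      by metis
  qed
  have w_space: "w t \<in> nakano_space p" for t using A_sum[OF fin] by (simp add: w_def)
  have Aw: "A (w t) = (\<lambda>j. \<Sum>s\<in>I. Q s t *\<^sub>R A (single s) j)" for t
    using A_sum[OF fin] by (simp add: w_def)
  have w_outside: "w t j = 0" if "j \<notin> {a..<b}" for t j
    using that unfolding w_def by (intro sum.neutral) (auto simp: I_def single_def)
  have w_coord: "w t j \<bullet> \<beta> = Q (j, \<beta>) t" if "(j, \<beta>) \<in> I" for t j \<beta>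
  proof -
    have "w t j \<bullet> \<beta> = (\<Sum>s\<in>I. if s = (j, \<beta>) then Q s t else 0)"
      unfolding w_def inner_sum_left
      using that by (intro sum.cong) (auto simp: I_def single_def inner_Basis split: if_splits)
    then show ?thesis using fin that by simp
  qed
  \<comment> \<open>Each row of \<open>Q\<close> has square sum \<open>Q s s\<close>, at most 1, and
    a coordinate \<open>j\<close> collects \<open>d\<close> rows.\<close>
  have w_sq: "(\<Sum>t\<in>I. (norm (w t j))\<^sup>2) \<le> real d" if "j \<in> {a..<b}" for j
  proof -
    have jI: "(j, \<beta>) \<in> I" if "\<beta> \<in> Basis" for \<beta> using that \<open>j \<in> {a..<b}\<close> by (simp add: I_def)
    have "(\<Sum>t\<in>I. (norm (w t j))\<^sup>2) = (\<Sum>t\<in>I. \<Sum>\<beta>\<in>Basis. (Q (j, \<beta>) t)\<^sup>2)"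
    proof (rule sum.cong[OF refl])
      fix t
      have "(norm (w t j))\<^sup>2 = (\<Sum>\<beta>\<in>Basis. (w t j \<bullet> \<beta>)\<^sup>2)"
        unfolding power2_norm_eq_inner by (subst euclidean_inner) (simp add: power2_eq_square)
      also have "\<dots> = (\<Sum>\<beta>\<in>Basis. (Q (j, \<beta>) t)\<^sup>2)" using jI by (simp add: w_coord)
      finally show "(norm (w t j))\<^sup>2 = (\<Sum>\<beta>\<in>Basis. (Q (j, \<beta>) t)\<^sup>2)" .
    qed
    also have "\<dots> = (\<Sum>\<beta>\<in>Basis. \<Sum>t\<in>I. (Q (j, \<beta>) t)\<^sup>2)" by (rule sum.swap)
    also have "\<dots> = (\<Sum>\<beta>\<in>Basis. Q (j, \<beta>) (j, \<beta>))" using jI by (simp add: Q_diag)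
    also have "\<dots> \<le> (\<Sum>\<beta>\<in>(Basis :: 'k set). 1)" using jI Q01 by (intro sum_mono) blast
    finally show ?thesis by (simp add: d_def)
  qed
  \<comment> \<open>The kernel conditions kill the even coordinates, and \<open>A_pair\<close>
    transfers this to the odd ones.\<close>
  have Aw_below: "A (w t) j = 0" if "t \<in> I" "j < b" for t j
  proof -
    have even_zero: "A (w t) (2 * i) = 0" if "i < b div 2" for i
    proof (rule euclidean_eqI)
      fix \<beta> :: 'k assume "\<beta> \<in> Basis"
      then have "(i, \<beta>) \<in> g ` {..<r}"
        unfolding bij_betw_imp_surj_on[OF g] using \<open>i < b div 2\<close> by simp
      then obtain l where l: "l < r" "g l = (i, \<beta>)" by auto
      have "A (w t) (2 * i) \<bullet> \<beta> = (\<Sum>s\<in>I. (A (single s) (2 * fst (g l)) \<bullet> snd (g l)) * Q s t)"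
        unfolding Aw inner_sum_left by (simp add: l mult.commute)
      also have "\<dots> = 0" using Q_ker[OF l(1) \<open>t \<in> I\<close>] .
      finally show "A (w t) (2 * i) \<bullet> \<beta> = 0 \<bullet> \<beta>" by simp
    qed
    have "j div 2 < b div 2" using \<open>j < b\<close> \<open>even b\<close> by (auto elim!: evenE)
    moreover have "j = 2 * (j div 2) \<or> j = Suc (2 * (j div 2))" by arith
    ultimately show ?thesis using even_zero A_pair[OF w_space] by metis
  qed

  obtain h where h: "bij_betw h {..<card I} I"
    using ex_bij_betw_nat_finite[OF fin] by (auto simp: atLeast0LessThan)
  then have h_in: "h i \<in> I" if "i < card I" for i using that bij_betwE by blast
  define x where "x i = (\<lambda>j. \<mu> *\<^sub>R w (h i) j)" for i
  define U where "U = {u \<in> nakano_space p. \<forall>j. j \<notin> {a..<b} \<longrightarrow> u j = (0::'k)}"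
  have U_scale: "(\<lambda>j. c *\<^sub>R u j) \<in> U" if "u \<in> U" for u c
    using that scaleR_nakano_space by (auto simp: U_def)
  have U_add: "u + v \<in> U" if "u \<in> U" "v \<in> U" for u v
    using that add_nakano_space by (auto simp: U_def)
  \<comment> \<open>Writing differences with the real scalar -1 reduces them to additivity and real
    homogeneity of \<open>A\<close>.\<close>
  have minus: "u - v = u + (\<lambda>j. (-1) *\<^sub>R v j)" for u v :: "nat \<Rightarrow> 'k"
    by (simp add: fun_eq_iff)
  have U_diff: "u - v \<in> U" if "u \<in> U" "v \<in> U" for u v
    unfolding minus using that U_add U_scale by blast
  have A_U: "A (u + v) = A u + A v \<and> A (u - v) = A u - A v" if "u \<in> U" "v \<in> U" for u v
  proof -
    have "u \<in> nakano_space p" "v \<in> nakano_space p" "(\<lambda>j. (-1) *\<^sub>R v j) \<in> nakano_space p"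
      using that scaleR_nakano_space by (auto simp only: U_def mem_Collect_eq)
    then show ?thesis unfolding minus by (simp only: A_add A_scale simp_thms)
  qed
  have x_U: "x i \<in> U" for i
    using scaleR_nakano_space[OF w_space] w_outside by (simp add: x_def U_def)
  have zero_U: "0 \<in> U" using zero_nakano_space by (simp add: U_def)
  have A0: "A 0 = 0"
    using A_add[OF zero_nakano_space zero_nakano_space] by simp

  \<comment> \<open>Half of the lower bound for the norm of \<open>A (x i)\<close>, so that the
    inequality is strict unless \<open>c i = 0\<close>.\<close>
  define c where "c i = \<mu> * (Q (h i) (h i) / (2 * C))" for i
  have "\<exists>F. finite F \<and> F \<subseteq> {b..} \<and> c i powr q \<le> modular p F (A (x i))" if "i < card I" for i
  proof (rule exists_modular_ge)
    let ?t = "h i"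
    have t: "?t \<in> I" using h_in that by simp
    note Qt = Q01[OF t]
    show x_space: "A (x i) \<in> nakano_space p" using x_U A_space by (auto simp: U_def)
    show "0 \<le> c i" using Qt \<mu> \<open>1 \<le> C\<close> by (simp add: c_def)
    have "Q ?t ?t / (2 * C) \<le> 1" using Qt \<open>1 \<le> C\<close> by (simp add: divide_le_eq)
    then show "c i \<le> 1" using Qt \<mu> \<open>1 \<le> C\<close> unfolding c_def by (intro mult_le_one) auto
    show "c i < nakano_norm p (A (x i)) \<or> c i = 0"
    proof (cases "Q ?t ?t = 0")
      case True
      then show ?thesis by (simp add: c_def)
    next
      case False
      have snd: "snd ?t \<in> Basis" using t by (auto simp: I_def)
      have "Q ?t ?t = w ?t (fst ?t) \<bullet> snd ?t" using w_coord[of "fst ?t" "snd ?t"] t by simp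
      also have "\<dots> \<le> norm (w ?t (fst ?t))" using Basis_le_norm[OF snd] by (meson abs_le_D1)
      finally have "\<mu> * Q ?t ?t \<le> norm (x i (fst ?t))" using \<mu> by (simp add: x_def)
      also have "\<dots> \<le> nakano_norm p (x i)" using x_U by (intro norm_le_nakano_norm) (simp add: U_def)
      also have "\<dots> \<le> C * nakano_norm p (A (x i))" using x_U by (intro A_ge) (simp add: U_def)
      finally have le: "\<mu> * Q ?t ?t \<le> C * nakano_norm p (A (x i))" .
      define e where "e = \<mu> * Q ?t ?t / C"
      have "e \<le> nakano_norm p (A (x i))"
        using le \<open>1 \<le> C\<close> by (simp add: e_def divide_le_eq mult.commute)
      moreover have "0 < e" using False Qt \<mu> \<open>1 \<le> C\<close> by (simp add: e_def)
      moreover have "c i = e / 2" by (simp add: c_def e_def)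
      ultimately have "c i < nakano_norm p (A (x i))" by linarith
      then show ?thesis ..
    qed
    fix j
    have "A (x i) = (\<lambda>j. \<mu> *\<^sub>R A (w ?t) j)" unfolding x_def by (rule A_scale[OF w_space])
    then show "A (x i) j = 0" if "j \<notin> {b..}" using that Aw_below[OF t] by simp
    show "p j \<le> q" if "j \<in> {b..}" using that p_above by simp
  qed
  then obtain G where G: "\<And>i. i < card I \<Longrightarrow> finite (G i)" "\<And>i. i < card I \<Longrightarrow> G i \<subseteq> {b..}"
    "\<And>i. i < card I \<Longrightarrow> c i powr q \<le> modular p (G i) (A (x i))"
    by metis
  \<comment> \<open>One finite set beyond the block that serves all the images at once.\<close>
  define F where "F = (\<Union>i<card I. G i)"
  have F: "finite F" "F \<subseteq> {b..}" using G by (auto simp: F_def)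

  define K where "K = 1 + C ^ 4 * (1 + 3 * (real d)\<^sup>2)"
  \<comment> \<open>The main chain: individual lower bounds, signed sums of the images, linearity of
    \<open>A\<close>, its norm bound, and the fourth-moment bound inside the block.\<close>
  have "(\<Sum>i<card I. c i powr q) \<le> (\<Sum>i<card I. modular p F (A (x i)))"
  proof (rule sum_mono)
    fix i assume i: "i \<in> {..<card I}"
    then have "G i \<subseteq> F" by (auto simp: F_def)
    then show "c i powr q \<le> modular p F (A (x i))"
      using G(3)[of i] modular_mono_set[OF F(1)] i by (meson lessThan_iff order_trans)
  qed
  also have "\<dots> \<le> signavg (card I) (\<lambda>i. A (x i)) (modular p F) 0"
    by (rule modular_signavg_ge[OF F(1)])
  also have "\<dots> = signavg (card I) x (\<lambda>u. modular p F (A u)) 0"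
    using signavg_comp[of U "card I" x 0 A "modular p F"] U_add U_diff x_U zero_U A_U A0 by simp
  also have "\<dots> \<le> signavg (card I) x (\<lambda>u. 1 + C ^ 4 * modular p {a..<b} u) 0"
  proof (rule signavg_mono[where U = U])
    fix u assume u: "u \<in> U"
    show "modular p F (A u) \<le> 1 + C ^ 4 * modular p {a..<b} u"
    proof (rule modular_image_le[where P = P])
      show "p j \<le> P" if "j \<in> F" for j
        using that F(2) p_above[of j] \<open>q \<le> P\<close> by force
    qed (use u A_space A_le p_block F(1) \<open>2 \<le> q\<close> \<open>q \<le> P\<close> \<open>P \<le> 4\<close> \<open>1 \<le> C\<close> in \<open>auto simp: U_def\<close>)
  qed (use U_add U_diff x_U zero_U in auto)
  also have "\<dots> = 1 + C ^ 4 * signavg (card I) x (modular p {a..<b}) 0"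
    by (simp add: signavg_add signavg_const signavg_cmult)
  also have "\<dots> \<le> K"
  proof -
    have "signavg (card I) x (modular p {a..<b}) 0
        \<le> \<bar>\<mu>\<bar> powr P * (card {a..<b} * (1 + 3 * (real d)\<^sup>2))"
      unfolding x_def
    proof (rule modular_signavg_le)
      fix j assume j: "j \<in> {a..<b}"
      have "(\<Sum>i<card I. (norm (w (h i) j))\<^sup>2) = (\<Sum>t\<in>I. (norm (w t j))\<^sup>2)"
        by (rule sum.reindex_bij_betw[OF h])
      then show "(\<Sum>i<card I. (norm (w (h i) j))\<^sup>2) \<le> real d" using w_sq[OF j] by simp
    qed (use p_block in auto)
    also have "\<dots> = 1 + 3 * (real d)\<^sup>2"
      using \<mu> N by (simp add: N_def[symmetric])
    finally show ?thesis using \<open>1 \<le> C\<close> by (simp add: K_def)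
  qed
  finally have upper: "(\<Sum>i<card I. c i powr q) \<le> K" .

  \<comment> \<open>As the base lies in the unit interval and \<open>q <= 4\<close>, the fourth
    power is smaller; 16 comes from the half in \<open>c\<close>.\<close>
  have lower: "\<mu> powr q * (Q (h i) (h i) ^ 4 / (16 * C ^ 4)) \<le> c i powr q" if "i < card I" for i
  proof -
    let ?z = "Q (h i) (h i) / (2 * C)"
    have Qt: "0 \<le> Q (h i) (h i)" "Q (h i) (h i) \<le> 1" using Q01 h_in that by auto
    then have z: "0 \<le> ?z" "?z \<le> 1" using \<open>1 \<le> C\<close> by (auto simp: divide_le_eq)
    have "Q (h i) (h i) ^ 4 / (16 * C ^ 4) = ?z powr 4"
      using z by (simp add: power_divide power_mult_distrib)
    also have "\<dots> \<le> ?z powr q" using z \<open>q \<le> P\<close> \<open>P \<le> 4\<close> by (intro powr_mono') auto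
    finally show ?thesis unfolding c_def powr_mult by (rule mult_left_mono) simp
  qed
  \<comment> \<open>The tangent line at \<open>1/4\<close>, the lower bound for the average of the \<open>Q s s\<close>.\<close>
  have tangent: "t / 16 - 3 / 256 \<le> t ^ 4" for t :: real
  proof -
    have "t ^ 4 - (t / 16 - 3 / 256) = (t - 1/4)\<^sup>2 * ((t + 1/4)\<^sup>2 + 1/8)"
      by (simp add: power2_eq_square power4_eq_xxxx algebra_simps)
    also have "\<dots> \<ge> 0" by simp
    finally show ?thesis by simp
  qed
  \<comment> \<open>Since \<open>b\<close> is at least \<open>4 * a\<close>, imposing
    \<open>b div 2\<close> conditions per real direction leaves at least a quarter of the
    block.\<close>
  have trace: "real d * real N / 4 \<le> (\<Sum>s\<in>I. Q s s)"
  proof -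
    have "real N = real b - real a" using \<open>4 * a \<le> b\<close> by (simp add: N_def of_nat_diff)
    moreover have "real (b div 2) \<le> real b / 2" by linarith
    moreover have "4 * real a \<le> real b" using \<open>4 * a \<le> b\<close> by linarith
    ultimately have "real N / 4 \<le> real N - real (b div 2)" by linarith
    then have "real d * (real N / 4) \<le> real d * (real N - real (b div 2))" by (intro mult_left_mono) auto
    also have "\<dots> = real (card I) - real r" by (simp add: card_I r_def algebra_simps)
    finally show ?thesis using Q_trace by simp
  qed
  have "real d * real N / 256 = (real d * real N / 4) / 16 - 3 / 256 * (real N * real d)" by simp
  also have "\<dots> \<le> (\<Sum>s\<in>I. Q s s) / 16 - 3 / 256 * real (card I)"
    using trace by (simp add: card_I mult.commute)
  also have "\<dots> = (\<Sum>s\<in>I. Q s s / 16 - 3 / 256)" by (simp add: sum_subtractf sum_divide_distrib)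
  also have "\<dots> \<le> (\<Sum>s\<in>I. Q s s ^ 4)" by (intro sum_mono tangent)
  finally have sum4: "real d * real N / 256 \<le> (\<Sum>s\<in>I. Q s s ^ 4)" .
  have "\<mu> powr q * (real d * real N / 256 / (16 * C ^ 4)) \<le> \<mu> powr q * ((\<Sum>s\<in>I. Q s s ^ 4) / (16 * C ^ 4))"
    using sum4 \<open>1 \<le> C\<close> by (intro mult_left_mono divide_right_mono) auto
  also have "(\<Sum>s\<in>I. Q s s ^ 4) = (\<Sum>i<card I. Q (h i) (h i) ^ 4)"
    using sum.reindex_bij_betw[OF h, of "\<lambda>s. Q s s ^ 4"] by simp
  also have "\<mu> powr q * ((\<Sum>i<card I. Q (h i) (h i) ^ 4) / (16 * C ^ 4))
      = (\<Sum>i<card I. \<mu> powr q * (Q (h i) (h i) ^ 4 / (16 * C ^ 4)))"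
    by (simp add: sum_distrib_left sum_divide_distrib)
  also have "\<dots> \<le> (\<Sum>i<card I. c i powr q)" using lower by (intro sum_mono) auto
  also note upper
  \<comment> \<open>The factor 4096 is \<open>256 * 16\<close>, from the tangent line and from
    \<open>lower\<close>.\<close>
  finally have "real d * (real N * \<mu> powr q) \<le> 4096 * C ^ 4 * K"
    using \<open>1 \<le> C\<close> by (simp add: field_simps)
  moreover have "real N * \<mu> powr q \<le> real d * (real N * \<mu> powr q)"
    using mult_right_mono[of 1 "real d" "real N * \<mu> powr q"] d by simp
  ultimately have "real N * \<mu> powr q \<le> 4096 * C ^ 4 * K" by linarith
  then show ?thesis
    unfolding N_def[symmetric] d_def[symmetric] K_def[symmetric] \<mu>(4) .
qed

end

section \<open>Exponents decreasing along blocks\<close>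

text \<open>Block ends are even, so no pair is split. The fourth power makes blocks long enough to
  outweigh the shrinking gaps between consecutive exponents.\<close>

definition level :: "nat \<Rightarrow> nat" where
  "level j = (LEAST n. j < 2 ^ ((n + 1) ^ 4))"

text \<open>Starts at 4 and decreases to 2; for consecutive exponents \<open>P > q\<close> on levels
  \<open>n\<close> and \<open>n + 1\<close>, \<open>1 - q / P\<close> is exactly
  \<open>1 / (n + 2)\<^sup>2\<close>.\<close>

definition level_exponent :: "nat \<Rightarrow> real" where
  "level_exponent j = 2 + 2 / (real (level j) + 1)"

lemma level_eqI:
  assumes "2 ^ (n ^ 4) \<le> j" "j < 2 ^ ((n + 1) ^ 4)"
  shows "level j = n"
  unfolding level_def
proof (rule Least_equality)
  fix m assume "j < 2 ^ ((m + 1) ^ 4)"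
  with assms(1) have "(2::nat) ^ (n ^ 4) < 2 ^ ((m + 1) ^ 4)" by (rule le_less_trans)
  then have "n ^ 4 < (m + 1) ^ 4" by simp
  then have "n < m + 1" by (rule power_less_imp_less_base) simp
  then show "n \<le> m" by simp
qed fact

lemma less_level: "2 ^ (n ^ 4) \<le> j \<Longrightarrow> n \<le> level j"
proof -
  assume j: "2 ^ (n ^ 4) \<le> j"
  \<comment> \<open>The index \<open>j\<close> itself is a witness for the defining property, so the
    least one exists.\<close>
  have "j + 1 \<le> (j + 1) ^ 4" by (rule self_le_power) auto
  then have "(2::nat) ^ (j + 1) \<le> 2 ^ ((j + 1) ^ 4)" by (intro power_increasing) auto
  moreover have "j < 2 ^ (j + 1)" by (rule less_le_trans[OF less_exp]) simp
  ultimately have "j < 2 ^ ((j + 1) ^ 4)" by (rule less_le_trans[rotated])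
  then have "j < 2 ^ ((level j + 1) ^ 4)"
    unfolding level_def by (rule LeastI[of "\<lambda>n. j < 2 ^ ((n + 1) ^ 4)"])
  with j have "(2::nat) ^ (n ^ 4) < 2 ^ ((level j + 1) ^ 4)" by (rule le_less_trans)
  then have "n ^ 4 < (level j + 1) ^ 4" by simp
  then have "n < level j + 1" by (rule power_less_imp_less_base) simp
  then show ?thesis by simp
qed

text \<open>Every threshold is even, hence a pair lies entirely on one side of it.\<close>

lemma level_pair_partner: "level (pair_partner j) = level j"
proof -
  have "pair_partner j < 2 * k \<longleftrightarrow> j < 2 * k" for k
    by (cases "even j") (auto simp: pair_partner_def elim!: evenE oddE)
  moreover have "\<exists>k. (2::nat) ^ ((n + 1) ^ 4) = 2 * k" for n
    using dvd_power[of "(n + 1) ^ 4" "2::nat"] by (auto simp: dvd_def)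
  ultimately have "pair_partner j < 2 ^ ((n + 1) ^ 4) \<longleftrightarrow> j < 2 ^ ((n + 1) ^ 4)" for n
    by metis
  then show ?thesis by (simp add: level_def)
qed

lemma level_power_growth:
  "(2::nat) ^ (n ^ 4) * 4 \<le> 2 ^ ((n + 1) ^ 4)" if "1 \<le> n"
proof -
  have "(n + 1) ^ 4 = n ^ 4 + (4 * n ^ 3 + 6 * n\<^sup>2 + 4 * n + 1)"
    by (simp add: power4_eq_xxxx power3_eq_cube power2_eq_square algebra_simps)
  then have "n ^ 4 + 2 \<le> (n + 1) ^ 4" using that by simp
  then have "(2::nat) ^ (n ^ 4 + 2) \<le> 2 ^ ((n + 1) ^ 4)" by (intro power_increasing) auto
  then show ?thesis by (simp add: power_add)
qed

text \<open>The block has length at least \<open>2 ^ m\<close> with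
  \<open>m = (n + 1) ^ 4 - 1\<close>, and \<open>m\<close> is at least
  \<open>n * (n + 2)\<^sup>2\<close>, while the exponent is
  \<open>1 / (n + 2)\<^sup>2\<close>.\<close>

lemma level_block_growth:
  assumes "1 \<le> n"
  shows "2 ^ n \<le> real (2 ^ ((n + 1) ^ 4) - 2 ^ (n ^ 4))
    powr (1 - (2 + 2 / (real n + 2)) / (2 + 2 / (real n + 1)))"
proof -
  define m where "m = (n + 1) ^ 4 - 1"
  have m: "(n + 1) ^ 4 = Suc m" by (simp add: m_def)
  have "real m = (real n + 1) ^ 4 - 1" using arg_cong[OF m, of real] by (simp add: add.commute)
  also have "\<dots> = real n * (real n + 2) * ((real n)\<^sup>2 + 2 * real n + 2)"
    by (simp add: power4_eq_xxxx power2_eq_square algebra_simps)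
  finally have real_m: "real m = real n * (real n + 2) * ((real n)\<^sup>2 + 2 * real n + 2)" .
  have expo: "1 - (2 + 2 / (real n + 2)) / (2 + 2 / (real n + 1)) = 1 / (real n + 2)\<^sup>2"
  proof -
    have ratio: "(2 * x / y) / (2 * y / z) = x * z / y\<^sup>2" for x y z :: real
      by (simp add: power2_eq_square)
    have "2 + 2 / (real n + 2) = 2 * (real n + 3) / (real n + 2)"
      "2 + 2 / (real n + 1) = 2 * (real n + 2) / (real n + 1)"
      by (simp_all add: field_simps)
    moreover have "1 - (2 * (real n + 3) / (real n + 2)) / (2 * (real n + 2) / (real n + 1))
      = ((real n + 2)\<^sup>2 - (real n + 3) * (real n + 1)) / (real n + 2)\<^sup>2"
      unfolding ratio by (simp add: diff_divide_distrib)
    moreover have "(real n + 2)\<^sup>2 - (real n + 3) * (real n + 1) = 1"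
      by (simp add: power2_eq_square algebra_simps)
    ultimately show ?thesis by simp
  qed
  \<comment> \<open>Removing the earlier coordinates costs at most half of
    \<open>2 ^ ((n + 1) ^ 4)\<close>.\<close>
  have "(2::nat) ^ (n ^ 4) \<le> 2 ^ m" using level_power_growth[OF assms] unfolding m power_Suc by linarith
  then have "(2::nat) ^ m \<le> 2 ^ ((n + 1) ^ 4) - 2 ^ (n ^ 4)" unfolding m power_Suc by linarith
  then have base: "2 ^ m \<le> real (2 ^ ((n + 1) ^ 4) - 2 ^ (n ^ 4))"
    using of_nat_mono[where 'a = real] by fastforce
  have "real n * (real n + 2)\<^sup>2 \<le> real m"
    unfolding real_m by (simp add: power2_eq_square algebra_simps)
  then have "real n \<le> real m * (1 / (real n + 2)\<^sup>2)" by (simp add: field_simps)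
  then have "2 powr real n \<le> 2 powr (real m * (1 / (real n + 2)\<^sup>2))" by (rule powr_mono) simp
  also have "\<dots> = (2 ^ m) powr (1 / (real n + 2)\<^sup>2)"
    by (simp only: powr_powr[symmetric]) (simp add: powr_realpow)
  also have "\<dots> \<le> real (2 ^ ((n + 1) ^ 4) - 2 ^ (n ^ 4)) powr (1 / (real n + 2)\<^sup>2)"
    by (rule powr_mono2[OF _ _ base]) auto
  finally show ?thesis by (simp add: expo powr_realpow)
qed

section \<open>The chosen exponents and the failure of factorization\<close>

lemma nakano_level_exponent: "nakano level_exponent"
  by unfold_locales (simp_all add: level_exponent_def divide_le_eq)

text \<open>Apply \<open>block_bound\<close> to \<open>pair_sum\<close> after \<open>R\<close> on
  every block: the right-hand side stays fixed while the left-hand side is at least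
  \<open>2 ^ n\<close>.\<close>

lemma identity_not_factor_pair_sum:
  fixes X :: "(nat \<Rightarrow> 'k::{real_normed_field,euclidean_space}) set"
  assumes X: "X = nakano_space level_exponent" and N: "N = nakano_norm level_exponent"
  shows "\<not> banach_space.identity_factors_through coord_scale X N pair_sum"
proof
  interpret nakano level_exponent by (rule nakano_level_exponent)
  interpret banach_space "coord_scale :: 'k \<Rightarrow> (nat \<Rightarrow> 'k) \<Rightarrow> nat \<Rightarrow> 'k" X N
    unfolding X N by (rule banach_space_nakano)
  assume "identity_factors_through pair_sum"
  then obtain R S where R: "bounded_operator R" and S: "bounded_operator S"
    and id: "\<And>x. x \<in> X \<Longrightarrow> S (pair_sum (R x)) = x"
    unfolding identity_factors_through_def by metis
  obtain CR where CR: "\<And>x. x \<in> X \<Longrightarrow> N (R x) \<le> CR * N x"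
    using R unfolding bounded_operator_def by blast
  obtain CS where CS: "\<And>x. x \<in> X \<Longrightarrow> N (S x) \<le> CS * N x"
    using S unfolding bounded_operator_def by blast
  have R_space: "R x \<in> X" if "x \<in> X" for x using R that unfolding bounded_operator_def by blast
  define A where "A x = pair_sum (R x)" for x
  \<comment> \<open>One constant for both directions: \<open>2 * \<bar>CR\<bar>\<close> bounds
    \<open>A\<close>, \<open>\<bar>CS\<bar>\<close> bounds the left inverse \<open>S\<close>, and 1
    ensures \<open>1 <= C\<close>.\<close>
  define C where "C = 1 + 2 * \<bar>CR\<bar> + \<bar>CS\<bar>"
  have p_pair: "level_exponent (pair_partner j) = level_exponent j" for j
    by (simp add: level_exponent_def level_pair_partner)
  have A_space: "A x \<in> X" if "x \<in> X" for x
    using pair_sum_bounded(1)[OF p_pair] R_space[OF that] unfolding X A_def by blast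
  have N0: "0 \<le> N x" if "x \<in> X" for x using N_nonneg[OF that] .
  have bound: "2 ^ n \<le> 4096 * C ^ 4 * (1 + C ^ 4 * (1 + 3 * (real DIM('k))\<^sup>2))" if n: "1 \<le> n" for n
  proof -
    let ?a = "2 ^ (n ^ 4) :: nat" and ?b = "2 ^ ((n + 1) ^ 4) :: nat"
    let ?P = "2 + 2 / (real n + 1)" and ?q = "2 + 2 / (real n + 2)"
    have "2 ^ n \<le> real (?b - ?a) powr (1 - ?q / ?P)"
      by (rule level_block_growth[OF n])
    also have "\<dots> \<le> 4096 * C ^ 4 * (1 + C ^ 4 * (1 + 3 * (real DIM('k))\<^sup>2))"
    proof (rule block_bound[where A = A])
      fix x y :: "nat \<Rightarrow> 'k" assume x: "x \<in> nakano_space level_exponent"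
      then have xX: "x \<in> X" by (simp add: X)
      show "A x \<in> nakano_space level_exponent" using A_space[OF xX] by (simp add: X)
      show "A x (Suc (2 * i)) = A x (2 * i)" for i by (simp add: A_def pair_sum_odd)
      show "A (\<lambda>j. c *\<^sub>R x j) = (\<lambda>j. c *\<^sub>R A x j)" for c
      proof -
        have "(\<lambda>j. c *\<^sub>R u j) = coord_scale (of_real c) u" for u :: "nat \<Rightarrow> 'k"
          by (simp add: coord_scale_def scaleR_conv_of_real)
        moreover have "R (coord_scale (of_real c) x) = coord_scale (of_real c) (R x)"
          using R xX unfolding bounded_operator_def by blast
        ultimately show ?thesis
          by (simp add: A_def pair_sum_def coord_scale_def distrib_left)
      qed
      have "N (A x) \<le> 2 * N (R x)"
        using pair_sum_bounded(2)[OF p_pair] R_space[OF xX] unfolding X N A_def by blast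
      also have "\<dots> \<le> 2 * (CR * N x)" using CR[OF xX] by simp
      also have "\<dots> = (2 * CR) * N x" by simp
      also have "\<dots> \<le> C * N x" using N0[OF xX] by (intro mult_right_mono) (auto simp: C_def)
      finally show "nakano_norm level_exponent (A x) \<le> C * nakano_norm level_exponent x"
        by (simp add: N)
      have "N x = N (S (A x))" using id[OF xX] by (simp add: A_def)
      also have "\<dots> \<le> CS * N (A x)" by (rule CS[OF A_space[OF xX]])
      also have "\<dots> \<le> C * N (A x)"
        using N0[OF A_space[OF xX]] by (intro mult_right_mono) (auto simp: C_def)
      finally show "nakano_norm level_exponent x \<le> C * nakano_norm level_exponent (A x)"
        by (simp add: N)
      assume y: "y \<in> nakano_space level_exponent"
      have "R (x + y) = R x + R y"
        using R xX y unfolding bounded_operator_def X[symmetric] by blast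
      then show "A (x + y) = A x + A y" by (simp add: A_def pair_sum_def fun_eq_iff)
    next
      show "4 * ?a \<le> ?b" using level_power_growth[OF n] by simp
      show "level_exponent j = ?P" if "?a \<le> j" "j < ?b" for j
        by (simp add: level_exponent_def level_eqI[OF that])
      show "level_exponent j \<le> ?q" if "?b \<le> j" for j
      proof -
        have "real n + 2 \<le> real (level j) + 1" using less_level[OF that] by simp
        then have "2 / (real (level j) + 1) \<le> 2 / (real n + 2)" by (intro divide_left_mono) auto
        then show ?thesis by (simp add: level_exponent_def)
      qed
    qed (auto simp: C_def field_simps)
    finally show ?thesis .
  qed
  obtain n where "4096 * C ^ 4 * (1 + C ^ 4 * (1 + 3 * (real DIM('k))\<^sup>2)) < 2 ^ n"
    using real_arch_pow[of 2] by auto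
  \<comment> \<open>The index moves to \<open>Suc n\<close> because \<open>bound\<close> starts at
    1.\<close>
  also have "(2::real) ^ n \<le> 2 ^ Suc n" by simp
  also have "\<dots> \<le> 4096 * C ^ 4 * (1 + C ^ 4 * (1 + 3 * (real DIM('k))\<^sup>2))"
    by (rule bound) simp
  finally show False by simp
qed

text \<open>The scalar type ranges over normed fields that are finite-dimensional Euclidean spaces,
  which covers both the real and the complex numbers.\<close>

theorem theorem2p1:
  "\<exists>(scale :: 'k::{real_normed_field,euclidean_space} \<Rightarrow> (nat \<Rightarrow> 'k) \<Rightarrow> (nat \<Rightarrow> 'k)) X N b T.
     banach_space scale X N \<and>
     banach_space.unconditional_basis scale X N b \<and>
     banach_space.normalized N b \<and>
     banach_space.bounded_operator scale X N T \<and>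
     banach_space.large_diagonal scale N b T \<and>
     \<not> banach_space.identity_factors_through scale X N T"
proof -
  interpret nakano level_exponent by (rule nakano_level_exponent)
  define X :: "(nat \<Rightarrow> 'k) set" where "X = nakano_space level_exponent"
  define N :: "(nat \<Rightarrow> 'k) \<Rightarrow> real" where "N = nakano_norm level_exponent"
  define b :: "nat \<Rightarrow> nat \<Rightarrow> 'k" where "b = unit_vec"
  have banach: "banach_space coord_scale X N"
    unfolding X_def N_def by (rule banach_space_nakano)
  interpret banach_space "coord_scale :: 'k \<Rightarrow> (nat \<Rightarrow> 'k) \<Rightarrow> nat \<Rightarrow> 'k" X N
    by (rule banach)
  have p_pair: "level_exponent (pair_partner j) = level_exponent j" for j
    by (simp add: level_exponent_def level_pair_partner)
  have "bounded_operator pair_sum"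
    unfolding bounded_operator_def
  proof (intro conjI ballI allI)
    show "pair_sum x \<in> X" if "x \<in> X" for x
      using pair_sum_bounded(1)[OF p_pair] that unfolding X_def by blast
    show "\<exists>C. \<forall>x\<in>X. N (pair_sum x) \<le> C * N x"
      using pair_sum_bounded(2)[OF p_pair] unfolding X_def N_def by blast
  qed (simp_all add: pair_sum_def coord_scale_def fun_eq_iff algebra_simps)
  moreover have "large_diagonal b pair_sum"
  proof -
    have "coordinate b n (pair_sum (b n)) = 1" for n
    proof -
      have "pair_sum (unit_vec n :: nat \<Rightarrow> 'k) \<in> nakano_space level_exponent"
        by (rule pair_sum_bounded(1)[OF p_pair unit_vec_nakano_space])
      then have "coordinate b n (pair_sum (b n)) = pair_sum (b n) n"
        unfolding N_def b_def by (intro unit_vec_basis(3)) auto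
      \<comment> \<open>The partner of \<open>n\<close> is a different index, so it contributes 0 to
        the diagonal entry.\<close>
      then show ?thesis by (simp add: b_def pair_sum_def unit_vec_def pair_partner_neq)
    qed
    then show ?thesis by (simp add: large_diagonal_def)
  qed
  moreover have "unconditional_basis b" "normalized b"
    unfolding X_def N_def by (rule unit_vec_basis(1,2)[OF b_def])+
  moreover have "\<not> identity_factors_through pair_sum"
    by (rule identity_not_factor_pair_sum[OF X_def N_def])
  ultimately show ?thesis using banach by blast
qed

end
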